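(* Let $m,r$ be positive integers and $d$ a nonnegative integer. (i) If $P(\lambda)\in\mathrm{POL}^{ss}_{d,2r,m}$ and $\operatorname{rank}(P)=2r$, then $P(\lambda)=L(\lambda)E(\lambda)L(\lambda)^T$, where the columns of $L(\lambda)\in\mathrm{POL}^{m\times 2r}$ form a minimal basis of $\mathcal{C}ol(P)$ and $E(\lambda)\in\mathrm{POL}^{2r\times 2r}$ is skew-symmetric with $\operatorname{rank}(E)=2r$. (ii) If $P(\lambda)\in\mathrm{POL}^{ss}_{d,2r,m}$, $\operatorname{rank}(P)=2r$, $\deg(P)=d$, $P(\lambda)$ has no eigenvalues (finite or infinite), and the columns of $L(\lambda)$ in the factorization in item (i) are ordered in such a way that $\deg(L_{*1})\ge\deg(L_{*2})\ge\cdots\ge\deg(L_{*2r})$, then $$\deg(L_{*i})+\deg(L_{*(2r-i+1)})=d,\quad \text{for } i=1,\ldots,2r.$$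
   Context: All matrix polynomials have coefficients in $\mathbb{C}$. $\mathrm{POL}^{p\times q}$ is the set of all $p\times q$ matrix polynomials. The degree of a matrix polynomial is the largest power of $\lambda$ with a nonzero matrix coefficient. $L_{*i}$ is the $i$-th column of $L(\lambda)$. The (normal) rank of a matrix polynomial is its rank over the field $\mathbb{C}(\lambda)$. $\mathrm{POL}^{ss}_{d,2r,m}$ is the set of $m\times m$ skew-symmetric matrix polynomials $P(\lambda)=\sum_{i=0}^d\lambda^iA_i$ ($A_i\in\mathbb{C}^{m\times m}$, $A_i^T=-A_i$) of degree at most $d$ and normal rank at most $2r$. $\mathcal{C}ol(P)$ is the rational column space of $P$, i.e. the subspace of $\mathbb{C}(\lambda)^m$ spanned over $\mathbb{C}(\lambda)$ by the columns of $P(\lambda)$. A minimal basis of a subspace $\mathcal{V}\subseteq\mathbb{C}(\lambda)^m$ is a basis of $\mathcal{V}$ consisting of vector polynomials whose sum of degrees is minimal among all bases of $\mathcal{V}$ consisting of vector polynomials. Eigenvalues: $\alpha\in\mathbb{C}$ is a finite eigenvalue of $P(\lambda)$ if it is a root of at least one of the invariant polynomials of $P(\lambda)$ (the nonzero diagonal entries of its Smith form over $\mathbb{C}[\lambda]$); equivalently, $\operatorname{rank}P(\alpha)<\operatorname{rank}(P)$. $\infty$ is an eigenvalue of $P(\lambda)$, regarded as a polynomial of grade $d$, if $0$ is an eigenvalue of $\mathrm{rev}_dP(\lambda):=\lambda^dP(1/\lambda)$. *)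

theory Defs
  imports "Jordan_Normal_Form.DL_Rank" "HOL-Computational_Algebra.Polynomial_Factorial"
begin

text \<open>
  A \<open>p \<times> q\<close> matrix polynomial over the complex numbers is an element of \<open>carrier_mat p q\<close> of type
  \<^typ>\<open>complex poly mat\<close>, and the field of rational functions is \<^typ>\<open>complex poly fract\<close>.
  Rows and columns are indexed from 0.
\<close>

definition vec_coeff :: "complex poly vec \<Rightarrow> nat \<Rightarrow> complex vec" where
  "vec_coeff v k = map_vec (\<lambda>p. coeff p k) v"

definition mat_coeff :: "complex poly mat \<Rightarrow> nat \<Rightarrow> complex mat" where
  "mat_coeff A k = map_mat (\<lambda>p. coeff p k) A"

text \<open>The degree of a zero vector or matrix is 0 by convention.\<close>

definition vec_degree :: "complex poly vec \<Rightarrow> nat" where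
  "vec_degree v = Max (insert 0 {k. vec_coeff v k \<noteq> 0\<^sub>v (dim_vec v)})"

definition mat_degree :: "complex poly mat \<Rightarrow> nat" where
  "mat_degree A = Max (insert 0 {k. mat_coeff A k \<noteq> 0\<^sub>m (dim_row A) (dim_col A)})"

definition rat_vec :: "complex poly vec \<Rightarrow> complex poly fract vec" where
  "rat_vec v = map_vec to_fract v"

definition rat_mat :: "complex poly mat \<Rightarrow> complex poly fract mat" where
  "rat_mat A = map_mat to_fract A"

definition normal_rank :: "complex poly mat \<Rightarrow> nat" where
  "normal_rank A = vec_space.rank (dim_row A) (rat_mat A)"

definition skew_symmetric_mat :: "'a :: ab_group_add mat \<Rightarrow> bool" where
  "skew_symmetric_mat A \<longleftrightarrow> square_mat A \<and> A\<^sup>T = - A"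

definition POL_ss :: "nat \<Rightarrow> nat \<Rightarrow> nat \<Rightarrow> complex poly mat set" where
  "POL_ss d k m = {P \<in> carrier_mat m m.
     (\<forall>i. skew_symmetric_mat (mat_coeff P i)) \<and> mat_degree P \<le> d \<and> normal_rank P \<le> k}"

definition rat_col_space :: "complex poly mat \<Rightarrow> complex poly fract vec set" where
  "rat_col_space P = vec_space.col_space (dim_row P) (rat_mat P)"

text \<open>
  A basis of a subspace \<open>V\<close> of the space of rational \<open>m\<close>-vectors that consists of vector
  polynomials, given as a list.
\<close>

definition poly_basis :: "nat \<Rightarrow> complex poly fract vec set \<Rightarrow> complex poly vec list \<Rightarrow> bool" where
  "poly_basis m V bs \<longleftrightarrow>
     set bs \<subseteq> carrier_vec m \<and> distinct bs \<and>
     LinearCombinations.module.lin_indpt class_ring (module_vec TYPE(complex poly fract) m) (rat_vec ` set bs) \<and>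
     LinearCombinations.module.span class_ring (module_vec TYPE(complex poly fract) m) (rat_vec ` set bs) = V"

definition minimal_basis :: "nat \<Rightarrow> complex poly fract vec set \<Rightarrow> complex poly vec list \<Rightarrow> bool" where
  "minimal_basis m V bs \<longleftrightarrow> poly_basis m V bs \<and>
     (\<forall>bs'. poly_basis m V bs' \<longrightarrow>
        sum_list (map vec_degree bs) \<le> sum_list (map vec_degree bs'))"

definition unimodular_mat :: "complex poly mat \<Rightarrow> bool" where
  "unimodular_mat U \<longleftrightarrow> square_mat U \<and> is_unit (det U)"

text \<open>
  As 0 divides only 0, the divisibility chain puts the zero diagonal entries of the Smith form last.
\<close>

definition smith_form :: "complex poly mat \<Rightarrow> complex poly mat \<Rightarrow> bool" where
  "smith_form A D \<longleftrightarrow>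
     D \<in> carrier_mat (dim_row A) (dim_col A) \<and> diagonal_mat D \<and>
     (\<forall>i < min (dim_row D) (dim_col D). D $$ (i, i) \<noteq> 0 \<longrightarrow> lead_coeff (D $$ (i, i)) = 1) \<and>
     (\<forall>i. Suc i < min (dim_row D) (dim_col D) \<longrightarrow> D $$ (i, i) dvd D $$ (Suc i, Suc i)) \<and>
     (\<exists>U V. U \<in> carrier_mat (dim_row A) (dim_row A) \<and> unimodular_mat U \<and>
            V \<in> carrier_mat (dim_col A) (dim_col A) \<and> unimodular_mat V \<and> U * A * V = D)"

definition invariant_polys :: "complex poly mat \<Rightarrow> complex poly set" where
  "invariant_polys A =
     {D $$ (i, i) | D i. smith_form A D \<and> i < min (dim_row A) (dim_col A) \<and> D $$ (i, i) \<noteq> 0}"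

definition finite_eigenvalue :: "complex poly mat \<Rightarrow> complex \<Rightarrow> bool" where
  "finite_eigenvalue A \<alpha> \<longleftrightarrow> (\<exists>g \<in> invariant_polys A. poly g \<alpha> = 0)"

text \<open>
  \<open>\<lambda>\<^sup>d P(1/\<lambda>)\<close> for \<open>P\<close> of degree at most \<open>d\<close>; the library's \<^const>\<open>reflect_poly\<close> uses the
  degree of each entry instead of the common grade \<open>d\<close>.
\<close>

definition rev_mat :: "nat \<Rightarrow> complex poly mat \<Rightarrow> complex poly mat" where
  "rev_mat d A = map_mat (\<lambda>p. \<Sum>i\<le>d. monom (coeff p i) (d - i)) A"

definition infinite_eigenvalue :: "nat \<Rightarrow> complex poly mat \<Rightarrow> bool" where
  "infinite_eigenvalue d A \<longleftrightarrow> finite_eigenvalue (rev_mat d A) 0"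

definition skew_factorization ::
  "nat \<Rightarrow> nat \<Rightarrow> complex poly mat \<Rightarrow> complex poly mat \<Rightarrow> complex poly mat \<Rightarrow> bool" where
  "skew_factorization m r P L E \<longleftrightarrow>
     L \<in> carrier_mat m (2 * r) \<and> E \<in> carrier_mat (2 * r) (2 * r) \<and>
     P = L * E * L\<^sup>T \<and>
     minimal_basis m (rat_col_space P) (cols L) \<and>
     skew_symmetric_mat E \<and> normal_rank E = 2 * r"

end

theory Submission
  imports Defs "HOL-Computational_Algebra.Fundamental_Theorem_Algebra"
begin

text \<open>
  A minimal basis \<open>L\<close> has full column rank at every point: a kernel vector of \<open>L(\<alpha>)\<close>, or of the matrix
  of leading column coefficients (the value at infinity), would allow an exchange that lowers the
  degree sum. Full rank at a point lets one cancel \<open>L\<close> from divisibility statements there.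
  Hence the rational solutions of \<open>P = L R\<close> and \<open>R\<^sup>T = L F\<close> are polynomial, which gives
  \<open>P = L E L\<^sup>T\<close> with \<open>E = F\<^sup>T\<close>.

  By the Smith form, if \<open>\<alpha>\<close> is not an eigenvalue of \<open>P\<close> and \<open>P v\<close> vanishes at \<open>\<alpha>\<close>, then \<open>P v\<close> is
  \<open>\<lambda> - \<alpha>\<close> times an element of the image of \<open>P\<close>; this forces \<open>E(\<alpha>)\<close> to be nonsingular.
  So \<open>det E\<close> is a nonzero constant. Writing \<open>\<delta>\<^sub>k\<close> for the column degrees of \<open>L\<close> and \<open>n = 2r\<close>, the same
  argument for the reversal of \<open>P\<close> at 0, where the middle factor has entries
  \<open>\<lambda>\<^bsup>d - \<delta>\<^sub>k - \<delta>\<^sub>l\<^esup> E\<^sub>k\<^sub>l(1/\<lambda>)\<close>, yields \<open>2 \<Sum> \<delta>\<^sub>k = n d\<close> and \<open>E\<^sub>k\<^sub>l = 0\<close> whenever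
  \<open>\<delta>\<^sub>k + \<delta>\<^sub>l > d\<close>. If \<open>\<delta>\<^sub>i + \<delta>\<^bsub>n+1-i\<^esub> > d\<close> for some \<open>i\<close>, then \<open>E\<close> has a zero block of size
  \<open>i \<times> (n + 1 - i)\<close> and is singular; so all these sums are at most \<open>d\<close>, and their total forces
  equality.
\<close>

subsection \<open>Existence of the Smith form\<close>

text \<open>A unit determinant stands for invertibility over the ring. The reduction uses only
  division with remainder, so it runs over any Euclidean ring; monic diagonal entries are arranged
  at the very end.\<close>

definition mat_equiv :: "nat \<Rightarrow> 'a :: euclidean_ring mat \<Rightarrow> 'a mat \<Rightarrow> bool" where
  "mat_equiv n A B \<longleftrightarrow>
     (\<exists>U V. U \<in> carrier_mat n n \<and> is_unit (det U) \<and> V \<in> carrier_mat n n \<and> is_unit (det V) \<and>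
            B = U * A * V)"

lemma mat_equiv_refl: "A \<in> carrier_mat n n \<Longrightarrow> mat_equiv n A A"
  unfolding mat_equiv_def by (intro exI[of _ "1\<^sub>m n"]) auto

lemma mat_equiv_trans:
  assumes A: "A \<in> carrier_mat n n" and "mat_equiv n A B" and "mat_equiv n B C"
  shows "mat_equiv n A C"
proof -
  from assms obtain U V U' V' where
    U: "U \<in> carrier_mat n n" "is_unit (det U)" "V \<in> carrier_mat n n" "is_unit (det V)" "B = U * A * V" and
    U': "U' \<in> carrier_mat n n" "is_unit (det U')" "V' \<in> carrier_mat n n" "is_unit (det V')" "C = U' * B * V'"
    unfolding mat_equiv_def by blast
  have "C = (U' * U) * A * (V * V')"
    using A U(1,3) U'(1,3) unfolding U(5) U'(5)
    by (simp add: assoc_mult_mat[of _ n n _ n _ n])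
  moreover have "is_unit (det (U' * U))" "is_unit (det (V * V'))"
    using U U' by (simp_all add: det_mult)
  ultimately show ?thesis
    unfolding mat_equiv_def using U(1,3) U'(1,3) by (metis mult_carrier_mat)
qed

lemma mat_equiv_transpose:
  assumes A: "A \<in> carrier_mat n n" and "mat_equiv n A B"
  shows "mat_equiv n A\<^sup>T B\<^sup>T"
proof -
  from assms obtain U V where
    U: "U \<in> carrier_mat n n" "is_unit (det U)" "V \<in> carrier_mat n n" "is_unit (det V)" "B = U * A * V"
    unfolding mat_equiv_def by blast
  have "B\<^sup>T = V\<^sup>T * A\<^sup>T * U\<^sup>T"
    using A U(1,3) unfolding U(5)
    by (simp add: transpose_mult[of _ n n _ n] assoc_mult_mat[of _ n n _ n _ n])
  then show ?thesis
    unfolding mat_equiv_def using U(1-4) by (metis det_transpose transpose_carrier_mat)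
qed

lemma mat_equiv_carrier: "mat_equiv n A B \<Longrightarrow> B \<in> carrier_mat n n"
  unfolding mat_equiv_def by auto

lemma mat_equiv_left:
  assumes "A \<in> carrier_mat n n" and "U \<in> carrier_mat n n" and "is_unit (det U)"
  shows "mat_equiv n A (U * A)"
  unfolding mat_equiv_def using assms by (intro exI[of _ U] exI[of _ "1\<^sub>m n"]) auto

lemma mat_equiv_addrow:
  assumes "A \<in> carrier_mat n n" and "i < n" and "l < n" and "i \<noteq> l"
  shows "mat_equiv n A (addrow a i l A)"
  using assms by (subst addrow_mat[of _ n]) (auto intro!: mat_equiv_left simp: det_addrow_mat)

lemma mat_equiv_swaprows:
  assumes "A \<in> carrier_mat n n" and "i < n" and "l < n" and "i \<noteq> l"
  shows "mat_equiv n A (swaprows i l A)"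
  using assms by (subst swaprows_mat[of _ n]) (auto intro!: mat_equiv_left simp: det_swaprows_mat)

text \<open>The invariant of the reduction: k diagonal entries are split off, and each divides the
  whole block from its position on. Divisibility of the whole block, unlike that of the next
  diagonal entry alone, survives later row operations.\<close>

definition partial_smith :: "nat \<Rightarrow> nat \<Rightarrow> 'a :: euclidean_ring mat \<Rightarrow> bool" where
  "partial_smith n k A \<longleftrightarrow> A \<in> carrier_mat n n \<and>
     (\<forall>i<n. \<forall>j<n. i \<noteq> j \<and> (i < k \<or> j < k) \<longrightarrow> A $$ (i, j) = 0) \<and>
     (\<forall>l i j. l < k \<and> l \<le> i \<and> i < n \<and> l \<le> j \<and> j < n \<longrightarrow> A $$ (l, l) dvd A $$ (i, j))"

lemma partial_smith_transpose: "partial_smith n k A \<Longrightarrow> partial_smith n k A\<^sup>T"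
  unfolding partial_smith_def by auto

text \<open>Rows with index at least k vanish in the first k columns, and a common divisor of two
  rows divides their combinations.\<close>

lemma partial_smith_addrow:
  assumes A: "partial_smith n k A" and il: "k \<le> i" "k \<le> l" "i < n" "l < n"
  shows "partial_smith n k (addrow a i l A)"
proof -
  have Ac: "A \<in> carrier_mat n n"
    and z: "\<And>i j. i < n \<Longrightarrow> j < n \<Longrightarrow> i \<noteq> j \<Longrightarrow> i < k \<or> j < k \<Longrightarrow> A $$ (i, j) = 0"
    and d: "\<And>l i j. l < k \<Longrightarrow> l \<le> i \<Longrightarrow> i < n \<Longrightarrow> l \<le> j \<Longrightarrow> j < n \<Longrightarrow> A $$ (l, l) dvd A $$ (i, j)"
    using A unfolding partial_smith_def by blast+
  have entry: "addrow a i l A $$ (p, q) = (if p = i then a * A $$ (l, q) + A $$ (p, q) else A $$ (p, q))"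
    if "p < n" "q < n" for p q
    using that Ac by auto
  have "addrow a i l A $$ (p, q) = 0" if "p < n" "q < n" "p \<noteq> q" "p < k \<or> q < k" for p q
    using that il z[of p q] z[of l q] by (auto simp: entry)
  moreover have "addrow a i l A $$ (t, t) dvd addrow a i l A $$ (p, q)"
    if "t < k" "t \<le> p" "p < n" "t \<le> q" "q < n" for t p q
    using that il d[of t p q] d[of t l q] by (auto simp: entry)
  ultimately show ?thesis unfolding partial_smith_def using Ac by simp
qed

lemma partial_smith_swaprows:
  assumes A: "partial_smith n k A" and il: "k \<le> i" "k \<le> l" "i < n" "l < n"
  shows "partial_smith n k (swaprows i l A)"
proof -
  have Ac: "A \<in> carrier_mat n n"
    and z: "\<And>i j. i < n \<Longrightarrow> j < n \<Longrightarrow> i \<noteq> j \<Longrightarrow> i < k \<or> j < k \<Longrightarrow> A $$ (i, j) = 0"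
    and d: "\<And>l i j. l < k \<Longrightarrow> l \<le> i \<Longrightarrow> i < n \<Longrightarrow> l \<le> j \<Longrightarrow> j < n \<Longrightarrow> A $$ (l, l) dvd A $$ (i, j)"
    using A unfolding partial_smith_def by blast+
  have entry: "swaprows i l A $$ (p, q) = A $$ (if p = i then l else if p = l then i else p, q)"
    if "p < n" "q < n" for p q
    using that Ac by auto
  have "swaprows i l A $$ (p, q) = 0" if "p < n" "q < n" "p \<noteq> q" "p < k \<or> q < k" for p q
    using that il z[of p q] z[of l q] z[of i q] by (auto simp: entry)
  moreover have "swaprows i l A $$ (t, t) dvd swaprows i l A $$ (p, q)"
    if "t < k" "t \<le> p" "p < n" "t \<le> q" "q < n" for t p q
    using that il d[of t p q] d[of t l q] d[of t i q] by (auto simp: entry)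
  ultimately show ?thesis unfolding partial_smith_def using Ac by simp
qed

text \<open>All matrices that can be reached at stage k. Transposition maps the class of
  \<open>A\<close> to that of its transpose, so column operations are row operations on the
  transpose.\<close>

definition smith_class :: "nat \<Rightarrow> nat \<Rightarrow> 'a :: euclidean_ring mat \<Rightarrow> 'a mat set" where
  "smith_class n k A = {B. mat_equiv n A B \<and> partial_smith n k B}"

lemma smith_class_addrow:
  assumes "A \<in> carrier_mat n n" "B \<in> smith_class n k A" and "k \<le> i" and "k \<le> l" and "i < n" and "l < n" "i \<noteq> l"
  shows "addrow a i l B \<in> smith_class n k A"
  using assms unfolding smith_class_def
  by (auto intro: partial_smith_addrow mat_equiv_trans[OF _ _ mat_equiv_addrow] dest: mat_equiv_carrier)

lemma smith_class_swaprows: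
  assumes "A \<in> carrier_mat n n" "B \<in> smith_class n k A" and "k \<le> i" and "k \<le> l" and "i < n" and "l < n" "i \<noteq> l"
  shows "swaprows i l B \<in> smith_class n k A"
  using assms unfolding smith_class_def
  by (auto intro: partial_smith_swaprows mat_equiv_trans[OF _ _ mat_equiv_swaprows] dest: mat_equiv_carrier)

lemma smith_class_transpose:
  assumes "A \<in> carrier_mat n n" "B \<in> smith_class n k A"
  shows "B\<^sup>T \<in> smith_class n k A\<^sup>T"
  using assms unfolding smith_class_def by (auto intro: partial_smith_transpose mat_equiv_transpose)

lemma smith_class_carrier: "B \<in> smith_class n k A \<Longrightarrow> B \<in> carrier_mat n n"
  unfolding smith_class_def partial_smith_def by auto

lemma smith_class_to_pivot_row:
  assumes A: "A \<in> carrier_mat n n" and B: "B \<in> smith_class n k A"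
    and i: "k \<le> i" "i < n" and j: "j < n"
  shows "\<exists>C \<in> smith_class n k A. C $$ (k, j) = B $$ (i, j)"
proof (cases "i = k")
  case False
  then show ?thesis
    using smith_class_swaprows[OF A B, of k i] i j smith_class_carrier[OF B]
    by (intro bexI[of _ "swaprows k i B"]) auto
qed (use B in auto)

text \<open>One row swap brings the entry into row k; a second one, made on the transpose, brings it
  into column k.\<close>

lemma smith_class_to_pivot:
  assumes A: "A \<in> carrier_mat n n" and B: "B \<in> smith_class n k A"
    and i: "k \<le> i" "i < n" and j: "k \<le> j" "j < n"
  shows "\<exists>C \<in> smith_class n k A. C $$ (k, k) = B $$ (i, j)"
proof -
  obtain C where C: "C \<in> smith_class n k A" "C $$ (k, j) = B $$ (i, j)"
    using smith_class_to_pivot_row[OF A B i j(2)] by blast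
  obtain D where D: "D \<in> smith_class n k A\<^sup>T" "D $$ (k, k) = C\<^sup>T $$ (j, k)"
    using smith_class_to_pivot_row[OF _ smith_class_transpose[OF A C(1)] j, of k] A i by auto
  then have "D\<^sup>T \<in> smith_class n k A"
    using smith_class_transpose[OF _ D(1)] A by simp
  moreover have "D\<^sup>T $$ (k, k) = B $$ (i, j)"
    using D smith_class_carrier[OF D(1)] smith_class_carrier[OF C(1)] C(2) i j by auto
  ultimately show ?thesis by blast
qed

text \<open>The pivot is minimal over the whole class rather than over one matrix. Hence any
  admissible operation that produces a smaller nonzero entry is already a contradiction, and no
  termination argument is required.\<close>

lemma smith_class_minimal:
  fixes A :: "'a :: euclidean_ring mat"
  assumes A: "A \<in> carrier_mat n n" and B: "B \<in> smith_class n k A"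
    and ij: "k \<le> i" "i < n" "k \<le> j" "j < n" "B $$ (i, j) \<noteq> 0"
  shows "\<exists>b. b \<noteq> 0 \<and> (\<exists>C \<in> smith_class n k A. C $$ (k, k) = b) \<and>
    (\<forall>C i j. C \<in> smith_class n k A \<and> k \<le> i \<and> i < n \<and> k \<le> j \<and> j < n \<and> C $$ (i, j) \<noteq> 0 \<longrightarrow>
       euclidean_size b \<le> euclidean_size (C $$ (i, j)))"
proof -
  let ?S = "{C $$ (i, j) | C i j. C \<in> smith_class n k A \<and> k \<le> i \<and> i < n \<and> k \<le> j \<and> j < n \<and> C $$ (i, j) \<noteq> 0}"
  have "B $$ (i, j) \<in> ?S" using B ij by blast
  then obtain b where b: "b \<in> ?S" and min: "\<And>c. c \<in> ?S \<Longrightarrow> euclidean_size b \<le> euclidean_size c"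
    using ex_has_least_nat[of "\<lambda>x. x \<in> ?S" _ euclidean_size] by blast
  from b obtain C i j where "C \<in> smith_class n k A" "k \<le> i" "i < n" "k \<le> j" "j < n" "b = C $$ (i, j)" "b \<noteq> 0"
    by blast
  then show ?thesis
    using smith_class_to_pivot[OF A, of C k i j] min by (intro exI[of _ b] conjI) blast+
qed

text \<open>If \<open>b\<close> does not divide an entry in its column, a row operation leaves the smaller
  remainder there.\<close>

lemma smith_class_clear_column:
  fixes A :: "'a :: euclidean_ring mat"
  assumes A: "A \<in> carrier_mat n n" and C: "C \<in> smith_class n k A" "C $$ (k, k) = b" and "b \<noteq> 0"
    and min: "\<And>C i. C \<in> smith_class n k A \<Longrightarrow> k \<le> i \<Longrightarrow> i < n \<Longrightarrow>
           C $$ (i, k) \<noteq> 0 \<Longrightarrow> euclidean_size b \<le> euclidean_size (C $$ (i, k))"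
    and k: "k < n" and t: "t \<le> n"
  shows "\<exists>D \<in> smith_class n k A. (\<forall>j<n. D $$ (k, j) = C $$ (k, j)) \<and> (\<forall>i<t. k < i \<longrightarrow> D $$ (i, k) = 0)"
  using t
proof (induction t)
  case 0
  then show ?case using C by blast
next
  case (Suc t)
  then obtain D where D: "D \<in> smith_class n k A" "\<forall>j<n. D $$ (k, j) = C $$ (k, j)"
    "\<forall>i<t. k < i \<longrightarrow> D $$ (i, k) = 0"
    by auto
  note Dc = smith_class_carrier[OF D(1)]
  show ?case
  proof (cases "k < t")
    case False
    then show ?thesis using D by (intro bexI[of _ D]) (auto simp: less_Suc_eq)
  next
    case True
    define D' where "D' = addrow (- (D $$ (t, k) div b)) t k D"
    have D': "D' \<in> smith_class n k A"
      unfolding D'_def using smith_class_addrow[OF A D(1)] True k Suc.prems by auto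
    have "D' $$ (t, k) = D $$ (t, k) mod b"
      using True k Suc.prems Dc D(2) C(2) unfolding D'_def by (auto simp: minus_div_mult_eq_mod[symmetric])
    moreover have "euclidean_size (D $$ (t, k) mod b) < euclidean_size b"
      using \<open>b \<noteq> 0\<close> by (rule mod_size_less)
    ultimately have "D' $$ (t, k) = 0"
      using min[OF D', of t] True Suc.prems by force
    moreover have "D' $$ (i, j) = D $$ (i, j)" if "i < n" "j < n" "i \<noteq> t" for i j
      using that Dc unfolding D'_def by auto
    ultimately show ?thesis
      using D' D True Suc.prems k by (intro bexI[of _ D']) (auto simp: less_Suc_eq)
  qed
qed

lemma partial_smith_step:
  fixes A :: "'a :: euclidean_ring mat"
  assumes A: "partial_smith n k A" and k: "k < n"
  shows "\<exists>B. mat_equiv n A B \<and> partial_smith n (Suc k) B"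
proof (cases "\<forall>i j. k \<le> i \<and> i < n \<and> k \<le> j \<and> j < n \<longrightarrow> A $$ (i, j) = 0")
  case True
  have Ac: "A \<in> carrier_mat n n" using A unfolding partial_smith_def by blast
  from True
  have "partial_smith n (Suc k) A"
    using A unfolding partial_smith_def
    by (metis (no_types, lifting) dvd_refl k less_or_eq_imp_le not_le less_Suc_eq)
  then show ?thesis using mat_equiv_refl[OF Ac] by blast
next
  case False
  have Ac: "A \<in> carrier_mat n n" using A unfolding partial_smith_def by blast
  have AA: "A \<in> smith_class n k A" using A Ac unfolding smith_class_def by (auto intro: mat_equiv_refl)
  from False obtain i j where "k \<le> i" "i < n" "k \<le> j" "j < n" "A $$ (i, j) \<noteq> 0" by blast
  from smith_class_minimal[OF Ac AA this] obtain b where b: "b \<noteq> 0" and Cex: "\<exists>C \<in> smith_class n k A. C $$ (k, k) = b"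
    and min: "\<And>C i j. C \<in> smith_class n k A \<Longrightarrow> k \<le> i \<Longrightarrow> i < n \<Longrightarrow> k \<le> j \<Longrightarrow> j < n \<Longrightarrow>
           C $$ (i, j) \<noteq> 0 \<Longrightarrow> euclidean_size b \<le> euclidean_size (C $$ (i, j))"
    by metis
  have minT: "euclidean_size b \<le> euclidean_size (C $$ (i, j))"
    if "C \<in> smith_class n k A\<^sup>T" "k \<le> i" "i < n" "k \<le> j" "j < n" "C $$ (i, j) \<noteq> 0" for C i j
    using min[of "C\<^sup>T" j i] smith_class_transpose[OF _ that(1)] smith_class_carrier[OF that(1)] that Ac by auto
  obtain C where C: "C \<in> smith_class n k A" "C $$ (k, k) = b" using Cex by blast
  obtain D where D: "D \<in> smith_class n k A" "D $$ (k, k) = b" "\<And>i. i < n \<Longrightarrow> k < i \<Longrightarrow> D $$ (i, k) = 0"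
    using smith_class_clear_column[OF Ac C b min k order.refl] C(2) k by auto
  have DT: "D\<^sup>T \<in> smith_class n k A\<^sup>T" using smith_class_transpose[OF Ac D(1)] .
  have Dc: "D \<in> carrier_mat n n" using smith_class_carrier[OF D(1)] .
  \<comment> \<open>Clearing the pivot column of the transpose leaves its pivot row alone, so the
    zeros already produced below the pivot of \<open>D\<close> survive.\<close>
  obtain F where F: "F \<in> smith_class n k A\<^sup>T" "\<And>j. j < n \<Longrightarrow> F $$ (k, j) = D\<^sup>T $$ (k, j)"
    "\<And>i. i < n \<Longrightarrow> k < i \<Longrightarrow> F $$ (i, k) = 0"
    using smith_class_clear_column[OF _ DT _ b minT k order.refl] Ac Dc D(2) k by auto
  define G where "G = F\<^sup>T"
  have G: "G \<in> smith_class n k A"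
    unfolding G_def using smith_class_transpose[OF _ F(1)] Ac by simp
  have Fc: "F \<in> carrier_mat n n" using smith_class_carrier[OF F(1)] .
  have Gc: "G \<in> carrier_mat n n" using smith_class_carrier[OF G] .
  have Gkk: "G $$ (k, k) = b" using F(2)[of k] D(2) Dc Fc k unfolding G_def by auto
  have Gcol: "G $$ (i, k) = 0" if "k < i" "i < n" for i
    using F(2)[of i] D(3)[of i] Dc Fc k that unfolding G_def by auto
  have Grow: "G $$ (k, j) = 0" if "k < j" "j < n" for j
    using F(3)[of j] Fc k that unfolding G_def by auto
  have dvd: "b dvd G $$ (i, j)" if ij: "k < i" "i < n" "k < j" "j < n" for i j
  proof -
    \<comment> \<open>Column k is zero below the pivot and row k is zero to its right. Adding row i
      to row k therefore keeps the pivot \<open>b\<close> and copies the entry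
      \<open>G $$ (i, j)\<close> into row k, where it can be reduced modulo
      \<open>b\<close>.\<close>
    define H where "H = addrow 1 k i G"
    have H: "H \<in> smith_class n k A" unfolding H_def using smith_class_addrow[OF Ac G, of k i] ij k by auto
    have Hc: "H \<in> carrier_mat n n" using smith_class_carrier[OF H] .
    have Hkk: "H $$ (k, k) = b" unfolding H_def using Gc ij k Gkk Gcol by auto
    have Hkj: "H $$ (k, j) = G $$ (i, j)" unfolding H_def using Gc ij k Grow by auto
    define H' where "H' = addrow (- (G $$ (i, j) div b)) j k H\<^sup>T"
    have H': "H' \<in> smith_class n k A\<^sup>T"
      unfolding H'_def using smith_class_addrow[OF _ smith_class_transpose[OF Ac H]] ij k Ac by auto
    have "H' $$ (j, k) = G $$ (i, j) mod b"
      unfolding H'_def using Hc ij k Hkk Hkj by (auto simp: minus_div_mult_eq_mod[symmetric])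
    moreover have "euclidean_size (G $$ (i, j) mod b) < euclidean_size b"
      using \<open>b \<noteq> 0\<close> by (rule mod_size_less)
    ultimately have "G $$ (i, j) mod b = 0"
      using minT[OF H', of j k] ij k by force
    then show ?thesis by (simp add: dvd_eq_mod_eq_0)
  qed
  have "partial_smith n (Suc k) G"
  proof -
    have Gp: "partial_smith n k G" using G unfolding smith_class_def by blast
    have "G $$ (i, j) = 0" if "i < n" "j < n" "i \<noteq> j" "i < Suc k \<or> j < Suc k" for i j
      using Gp Gcol[of i] Grow[of j] that unfolding partial_smith_def
      by (metis less_SucE linorder_neqE_nat)
    moreover have "G $$ (l, l) dvd G $$ (i, j)" if "l < Suc k" "l \<le> i" "i < n" "l \<le> j" "j < n" for l i j
    proof (cases "l < k")
      case True
      then show ?thesis using Gp that unfolding partial_smith_def by blast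
    next
      case False
      with that have "l = k" by simp
      then show ?thesis
        using that Gkk Gcol[of i] Grow[of j] dvd[of i j]
        by (cases "i = k"; cases "j = k") auto
    qed
    ultimately show ?thesis using Gc unfolding partial_smith_def by blast
  qed
  then show ?thesis using G unfolding smith_class_def by blast
qed

lemma partial_smith_exists:
  fixes A :: "'a :: euclidean_ring mat"
  assumes A: "A \<in> carrier_mat n n" and "k \<le> n"
  shows "\<exists>B. mat_equiv n A B \<and> partial_smith n k B"
  using assms(2)
proof (induction k)
  case 0
  have "partial_smith n 0 A" using A unfolding partial_smith_def by simp
  then show ?case using mat_equiv_refl[OF A] by blast
next
  case (Suc k)
  then show ?case
    using partial_smith_step[of n k] mat_equiv_trans[OF A] by (meson Suc_le_lessD Suc_leD)
qed

text \<open>Only the normalization to monic diagonal entries remains. Eigenvalues are defined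
  through some Smith form, so the absence of eigenvalues carries information only once such a form
  is known to exist.\<close>

theorem smith_form_exists:
  assumes A: "A \<in> carrier_mat n n"
  shows "\<exists>D. smith_form A D"
proof -
  obtain B where AB: "mat_equiv n A B" and B: "partial_smith n n B"
    using partial_smith_exists[OF A order.refl] by blast
  \<comment> \<open>The constants that make the nonzero diagonal entries monic; a zero entry gets 1,
    so that the scaling matrix stays unimodular.\<close>
  define u where "u i = (if B $$ (i, i) = 0 then 1 else [:inverse (lead_coeff (B $$ (i, i))):])" for i
  define W where "W = mat n n (\<lambda>(i, j). if i = j then u i else 0)"
  have Wc: "W \<in> carrier_mat n n" unfolding W_def by simp
  have Bc: "B \<in> carrier_mat n n" using B unfolding partial_smith_def by blast
  have uu: "is_unit (u i)" for i unfolding u_def by (auto simp: is_unit_const_poly_iff dvd_field_iff)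
  have detW: "is_unit (det W)"
  proof -
    have "upper_triangular W" unfolding W_def by (rule upper_triangularI) auto
    then have "det W = prod_list (diag_mat W)" using Wc by (rule det_upper_triangular)
    also have "\<dots> = (\<Prod>i<n. u i)"
      unfolding prod_list_diag_prod by (rule prod.cong) (auto simp: W_def)
    finally show ?thesis using uu prod_dvd_prod[of "{..<n}" u "\<lambda>_. 1"] by simp
  qed
  define D where "D = W * B"
  have D: "D $$ (i, j) = (if i = j then u i * B $$ (i, i) else 0)" if "i < n" "j < n" for i j
  proof -
    have "D $$ (i, j) = (\<Sum>l = 0..<n. W $$ (i, l) * B $$ (l, j))"
      unfolding D_def using that Wc Bc by (auto simp: scalar_prod_def)
    also have "\<dots> = (\<Sum>l = 0..<n. if l = i then u i * B $$ (i, j) else 0)"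
      by (rule sum.cong) (use that in \<open>auto simp: W_def\<close>)
    finally show ?thesis using that B unfolding partial_smith_def by auto
  qed
  have Dc: "D \<in> carrier_mat n n" unfolding D_def using Wc Bc by simp
  have AD: "mat_equiv n A D"
    unfolding D_def using mat_equiv_trans[OF A AB] mat_equiv_left[OF Bc Wc detW] by blast
  then obtain U V where "U \<in> carrier_mat n n" "is_unit (det U)" "V \<in> carrier_mat n n"
    "is_unit (det V)" "D = U * A * V"
    unfolding mat_equiv_def by blast
  then have "\<exists>U V. U \<in> carrier_mat n n \<and> unimodular_mat U \<and> V \<in> carrier_mat n n \<and> unimodular_mat V \<and> U * A * V = D"
    unfolding unimodular_mat_def by (intro exI[of _ U] exI[of _ V]) auto
  moreover have "lead_coeff (D $$ (i, i)) = 1" if "i < n" "D $$ (i, i) \<noteq> 0" for i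
    using that by (auto simp: D u_def)
  moreover have "D $$ (i, i) dvd D $$ (Suc i, Suc i)" if "Suc i < n" for i
  proof -
    have "B $$ (i, i) dvd B $$ (Suc i, Suc i)" using B that unfolding partial_smith_def by auto
    then show ?thesis using that uu by (simp add: D dvd_mult_unit_iff' mult_unit_dvd_iff')
  qed
  moreover have "diagonal_mat D" unfolding diagonal_mat_def using D Dc by auto
  ultimately have "smith_form A D" unfolding smith_form_def using A Dc by auto
  then show ?thesis by blast
qed

subsection \<open>Matrices of full column rank and eigenvalues\<close>

text \<open>Full column rank expressed as a trivial kernel, which makes sense over the complex
  numbers, the polynomials and the rational functions alike.\<close>

definition inj_mat :: "'a :: semiring_0 mat \<Rightarrow> bool" where
  "inj_mat A \<longleftrightarrow>
     (\<forall>v \<in> carrier_vec (dim_col A). A *\<^sub>v v = 0\<^sub>v (dim_row A) \<longrightarrow> v = 0\<^sub>v (dim_col A))"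

lemma inj_matD:
  "inj_mat A \<Longrightarrow> A \<in> carrier_mat m n \<Longrightarrow> v \<in> carrier_vec n \<Longrightarrow> A *\<^sub>v v = 0\<^sub>v m \<Longrightarrow> v = 0\<^sub>v n"
  unfolding inj_mat_def by auto

lemma inj_matI:
  "A \<in> carrier_mat m n \<Longrightarrow> (\<And>v. v \<in> carrier_vec n \<Longrightarrow> A *\<^sub>v v = 0\<^sub>v m \<Longrightarrow> v = 0\<^sub>v n) \<Longrightarrow> inj_mat A"
  unfolding inj_mat_def by auto

lemma inj_mat_cancel:
  fixes A :: "'a :: comm_ring_1 mat"
  assumes A: "inj_mat A" "A \<in> carrier_mat m n" and v: "v \<in> carrier_vec n" and w: "w \<in> carrier_vec n"
    and eq: "A *\<^sub>v v = A *\<^sub>v w"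
  shows "v = w"
proof -
  have "A *\<^sub>v (v - w) = A *\<^sub>v v - A *\<^sub>v w"
    using A v w by (simp add: mult_minus_distrib_mat_vec)
  also have "\<dots> = 0\<^sub>v m"
    unfolding eq using A(2) w by auto
  finally have *: "v - w = 0\<^sub>v n" using inj_matD[OF A, of "v - w"] v w by simp
  show ?thesis
  proof (rule eq_vecI)
    fix i assume "i < dim_vec w"
    then have "(v - w) $ i = 0" unfolding * using w by simp
    then show "v $ i = w $ i" using \<open>i < dim_vec w\<close> v w by simp
  qed (use v w in simp)
qed

lemma inj_mat_square_iff_det:
  assumes "(A :: 'a :: idom mat) \<in> carrier_mat n n"
  shows "inj_mat A \<longleftrightarrow> det A \<noteq> 0"
  using det_0_iff_vec_prod_zero[OF assms] assms unfolding inj_mat_def by auto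

lemma right_inverse_of_unit_det:
  assumes A: "(A :: 'a :: comm_ring_1 mat) \<in> carrier_mat n n" and "det A dvd 1"
  obtains B where "B \<in> carrier_mat n n" and "A * B = 1\<^sub>m n"
proof -
  from assms(2) obtain c where c: "1 = det A * c" by (elim dvdE)
  have "A * (c \<cdot>\<^sub>m adj_mat A) = c \<cdot>\<^sub>m (A * adj_mat A)"
    using A adj_mat(1)[OF A] by (simp add: mult_smult_distrib)
  also have "\<dots> = 1\<^sub>m n"
    unfolding adj_mat(2)[OF A] by (rule eq_matI) (auto simp: c[symmetric] mult.commute[of c])
  finally show ?thesis using that adj_mat(1)[OF A] by (meson smult_carrier_mat)
qed

lemma field_right_inverse:
  assumes A: "(A :: 'a :: field mat) \<in> carrier_mat n n" and "det A \<noteq> 0"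
  obtains B where "B \<in> carrier_mat n n" and "A * B = 1\<^sub>m n"
  using det_non_zero_imp_unit[OF assms, of "()"] unfolding Units_def ring_mat_def by auto

section \<open>Divisibility of vector polynomials and evaluation at a point\<close>

lemma smult_vec_factor:
  assumes "u \<in> carrier_vec n" and "\<And>i. i < n \<Longrightarrow> q dvd u $ i"
  obtains w where "w \<in> carrier_vec n" and "u = q \<cdot>\<^sub>v w"
proof -
  have "\<forall>i. \<exists>c. i < n \<longrightarrow> u $ i = q * c" using assms(2) by (auto elim: dvdE)
  then obtain c where c: "\<And>i. i < n \<Longrightarrow> u $ i = q * c i" by metis
  show ?thesis
    by (rule that[of "vec n c"]) (use assms(1) c in \<open>auto intro!: eq_vecI\<close>)
qed

lemma mult_mat_smult_vec:
  fixes A :: "'a :: comm_ring_1 mat"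
  assumes "A \<in> carrier_mat m n" and "v \<in> carrier_vec n"
  shows "A *\<^sub>v (k \<cdot>\<^sub>v v) = k \<cdot>\<^sub>v (A *\<^sub>v v)"
  using assms by (intro eq_vecI) auto

abbreviation eval_mat :: "complex poly mat \<Rightarrow> complex \<Rightarrow> complex mat" where
  "eval_mat A \<alpha> \<equiv> map_mat (\<lambda>p. poly p \<alpha>) A"

abbreviation eval_vec :: "complex poly vec \<Rightarrow> complex \<Rightarrow> complex vec" where
  "eval_vec v \<alpha> \<equiv> map_vec (\<lambda>p. poly p \<alpha>) v"

interpretation poly_at: comm_ring_hom "\<lambda>p. poly p \<alpha>" for \<alpha> :: "'a :: comm_ring_1"
  by unfold_locales auto

lemma eval_vec_eq_0_iff:
  assumes "v \<in> carrier_vec n"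
  shows "eval_vec v \<alpha> = 0\<^sub>v n \<longleftrightarrow> (\<forall>i<n. [:-\<alpha>, 1:] dvd v $ i)"
  using assms by (auto simp: vec_eq_iff poly_eq_0_iff_dvd)

text \<open>Induction on the degree of q, splitting off one linear factor \<lambda> - \<alpha>.
  After the other factor has been divided out of u, the quotient lies at \<alpha> in the kernel of
  L(\<alpha>), so it vanishes there.\<close>

theorem dvd_mult_mat_vecD:
  fixes L :: "complex poly mat"
  assumes L: "L \<in> carrier_mat m n" and u: "u \<in> carrier_vec n" and "q \<noteq> 0"
    and inj: "\<And>\<alpha>. poly q \<alpha> = 0 \<Longrightarrow> inj_mat (eval_mat L \<alpha>)"
    and dvd: "\<And>i. i < m \<Longrightarrow> q dvd (L *\<^sub>v u) $ i"
  shows "\<exists>w \<in> carrier_vec n. u = q \<cdot>\<^sub>v w"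
  using assms(3-)
proof (induction "degree q" arbitrary: q)
  case 0
  then have "is_unit q" by (simp add: is_unit_iff_degree)
  then show ?case using smult_vec_factor[OF u] by (metis unit_imp_dvd)
next
  case (Suc k)
  obtain \<alpha> where \<alpha>: "poly q \<alpha> = 0"
    using fundamental_theorem_of_algebra[of q] Suc.hyps(2) constant_degree[of q] by auto
  then obtain q' where q: "q = [:-\<alpha>, 1:] * q'" by (auto simp: poly_eq_0_iff_dvd)
  have q': "q' \<noteq> 0" using Suc.prems(1) q by auto
  have "degree q = Suc (degree q')"
    unfolding q using q' by (subst degree_mult_eq) auto
  then have "k = degree q'" using Suc.hyps(2) by simp
  moreover have "q' dvd (L *\<^sub>v u) $ i" if "i < m" for i
    using Suc.prems(3)[OF that] unfolding q using dvd_mult_right by blast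
  moreover have "inj_mat (eval_mat L \<beta>)" if "poly q' \<beta> = 0" for \<beta>
    using Suc.prems(2)[of \<beta>] that by (simp add: q)
  ultimately obtain w where w: "w \<in> carrier_vec n" "u = q' \<cdot>\<^sub>v w"
    using Suc.hyps(1)[of q'] q' by blast
  have "[:-\<alpha>, 1:] dvd (L *\<^sub>v w) $ i" if "i < m" for i
  proof -
    have "(L *\<^sub>v u) $ i = q' * (L *\<^sub>v w) $ i"
      unfolding w(2) using L w(1) that by (simp add: mult_mat_smult_vec)
    then have "[:-\<alpha>, 1:] * q' dvd (L *\<^sub>v w) $ i * q'"
      using Suc.prems(3)[OF that] by (simp add: q mult.commute)
    then show ?thesis using dvd_times_right_cancel_iff[OF q'] by blast
  qed
  then have "eval_vec (L *\<^sub>v w) \<alpha> = 0\<^sub>v m"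
    using L w(1) by (subst eval_vec_eq_0_iff) auto
  then have "eval_mat L \<alpha> *\<^sub>v eval_vec w \<alpha> = 0\<^sub>v m"
    using poly_at.mult_mat_vec_hom[OF L w(1)] by simp
  then have "eval_vec w \<alpha> = 0\<^sub>v n"
    using inj_matD[OF Suc.prems(2)[OF \<alpha>], of m n] L w(1) by simp
  then have "\<forall>i<n. [:-\<alpha>, 1:] dvd w $ i" using eval_vec_eq_0_iff[OF w(1)] by blast
  then obtain w' where "w' \<in> carrier_vec n" "w = [:-\<alpha>, 1:] \<cdot>\<^sub>v w'"
    using smult_vec_factor[OF w(1)] by metis
  then show ?case
    unfolding w(2) q by (intro bexI[of _ w']) (auto simp: smult_smult_assoc mult.commute)
qed

text \<open>A kernel vector would be divisible by every power of \<lambda> - \<alpha>; a power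
  beyond the degree of a nonzero entry gives the contradiction.\<close>

lemma inj_mat_of_eval:
  fixes L :: "complex poly mat"
  assumes L: "L \<in> carrier_mat m n" and inj: "inj_mat (eval_mat L \<alpha>)"
  shows "inj_mat L"
proof (rule inj_matI[OF L])
  fix u assume u: "u \<in> carrier_vec n" "L *\<^sub>v u = 0\<^sub>v m"
  show "u = 0\<^sub>v n"
  proof (rule ccontr)
    assume "u \<noteq> 0\<^sub>v n"
    then obtain i where i: "i < n" "u $ i \<noteq> 0" using u(1) by (auto simp: vec_eq_iff)
    define q where "q = [:-\<alpha>, 1:] ^ Suc (degree (u $ i))"
    have "q \<noteq> 0" unfolding q_def by (simp only: power_eq_0_iff) simp
    moreover have "inj_mat (eval_mat L \<beta>)" if "poly q \<beta> = 0" for \<beta>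
      using inj that unfolding q_def by (simp only: poly_power power_eq_0_iff) simp
    moreover have "q dvd (L *\<^sub>v u) $ i" if "i < m" for i using that unfolding u(2) by simp
    ultimately have "\<exists>w \<in> carrier_vec n. u = q \<cdot>\<^sub>v w"
      by (rule dvd_mult_mat_vecD[OF L u(1)])
    then obtain w where "w \<in> carrier_vec n" "u = q \<cdot>\<^sub>v w" by blast
    then have "q dvd u $ i" using i by (metis carrier_vecD dvd_triv_left index_smult_vec(1))
    then have "degree q \<le> degree (u $ i)" using i(2) by (rule dvd_imp_degree_le)
    then show False unfolding q_def by (subst (asm) degree_power_eq) simp_all
  qed
qed

text \<open>In the coordinates \<open>w\<close> with \<open>v = V w\<close>, the matrix acts
  diagonally up to the unimodular factor \<open>U\<close>. A nonzero diagonal entry has no root at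
  \<alpha>, so \<lambda> - \<alpha> divides the corresponding coordinate of \<open>w\<close>
  itself.\<close>

theorem not_eigenvalue_saturated:
  fixes A :: "complex poly mat"
  assumes A: "A \<in> carrier_mat m m" and ne: "\<not> finite_eigenvalue A \<alpha>"
    and v: "v \<in> carrier_vec m" and Av: "eval_vec (A *\<^sub>v v) \<alpha> = 0\<^sub>v m"
  shows "\<exists>w \<in> carrier_vec m. A *\<^sub>v v = [:-\<alpha>, 1:] \<cdot>\<^sub>v (A *\<^sub>v w)"
proof -
  let ?q = "[:-\<alpha>, 1:]"
  obtain D where sm: "smith_form A D" using smith_form_exists[OF A] by blast
  then obtain U V where U: "U \<in> carrier_mat m m" "is_unit (det U)"
    and V: "V \<in> carrier_mat m m" "is_unit (det V)" and D: "D = U * A * V" "D \<in> carrier_mat m m" "diagonal_mat D"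
    unfolding smith_form_def unimodular_mat_def using A by auto
  have root: "poly (D $$ (i, i)) \<alpha> \<noteq> 0" if "i < m" "D $$ (i, i) \<noteq> 0" for i
    using ne that sm A unfolding finite_eigenvalue_def invariant_polys_def by auto
  obtain V' where V': "V' \<in> carrier_mat m m" "V * V' = 1\<^sub>m m"
    using right_inverse_of_unit_det[OF V] .
  define w where "w = V' *\<^sub>v v"
  have w: "w \<in> carrier_vec m" unfolding w_def using V' v by simp
  have Vw: "V *\<^sub>v w = v"
    unfolding w_def using V(1) V' v by (simp flip: assoc_mult_mat_vec)
  have Dx: "D *\<^sub>v x = U *\<^sub>v (A *\<^sub>v (V *\<^sub>v x))" if "x \<in> carrier_vec m" for x
    unfolding D(1) using U(1) A V(1) that by (simp add: assoc_mult_mat_vec[of _ m m _ m])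
  have Dxi: "(D *\<^sub>v x) $ i = D $$ (i, i) * x $ i" if "x \<in> carrier_vec m" "i < m" for x i
  proof -
    have "(D *\<^sub>v x) $ i = (\<Sum>j = 0..<m. D $$ (i, j) * x $ j)"
      using D(2) that by (auto simp: scalar_prod_def)
    also have "\<dots> = (\<Sum>j = 0..<m. if j = i then D $$ (i, i) * x $ i else 0)"
      by (rule sum.cong) (use D(2,3) that in \<open>auto simp: diagonal_mat_def\<close>)
    finally show ?thesis using that by simp
  qed
  obtain y where y: "y \<in> carrier_vec m" "A *\<^sub>v v = ?q \<cdot>\<^sub>v y"
    using smult_vec_factor[of "A *\<^sub>v v" m ?q] Av eval_vec_eq_0_iff[of "A *\<^sub>v v" m \<alpha>] A v by auto
  have qw: "?q dvd D $$ (i, i) * w $ i" if "i < m" for i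
  proof -
    have "D $$ (i, i) * w $ i = (U *\<^sub>v (?q \<cdot>\<^sub>v y)) $ i"
      using Dxi[OF w that] Dx[OF w] y(2) Vw by simp
    also have "\<dots> = ?q * (U *\<^sub>v y) $ i" using U(1) y(1) that by (simp add: mult_mat_smult_vec)
    finally show ?thesis by (rule dvdI)
  qed
  \<comment> \<open>Where the diagonal entry is zero, \<lambda> - \<alpha> may fail to divide the
    coordinate of \<open>w\<close>; the value 0 is safe there, as \<open>D\<close> annihilates that
    coordinate.\<close>
  define z where "z = vec m (\<lambda>i. if D $$ (i, i) = 0 then 0 else w $ i div ?q)"
  have z: "z \<in> carrier_vec m" unfolding z_def by simp
  have "D *\<^sub>v w = ?q \<cdot>\<^sub>v (D *\<^sub>v z)"
  proof (rule eq_vecI)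
    fix i assume "i < dim_vec (?q \<cdot>\<^sub>v (D *\<^sub>v z))"
    then have i: "i < m" using D(2) by simp
    show "(D *\<^sub>v w) $ i = (?q \<cdot>\<^sub>v (D *\<^sub>v z)) $ i"
    proof (cases "D $$ (i, i) = 0")
      case True
      then show ?thesis using i D(2) Dxi[OF w i] Dxi[OF z i] by simp
    next
      case False
      then have "poly (w $ i) \<alpha> = 0" using qw[OF i] root[OF i] by (simp flip: poly_eq_0_iff_dvd)
      then have "?q * (w $ i div ?q) = w $ i" unfolding poly_eq_0_iff_dvd by (rule dvd_mult_div_cancel)
      moreover have "z $ i = w $ i div ?q" using False i by (simp add: z_def)
      ultimately have "D $$ (i, i) * w $ i = ?q * (D $$ (i, i) * z $ i)"
        by (metis mult.left_commute)
      then show ?thesis using i D(2) by (simp only: Dxi[OF w i] Dxi[OF z i] index_smult_vec dim_mult_mat_vec carrier_matD)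
    qed
  qed (use D(2) in simp)
  then have "U *\<^sub>v (A *\<^sub>v v) = ?q \<cdot>\<^sub>v (U *\<^sub>v (A *\<^sub>v (V *\<^sub>v z)))"
    by (simp only: Dx[OF w] Dx[OF z] Vw)
  also have "\<dots> = U *\<^sub>v (?q \<cdot>\<^sub>v (A *\<^sub>v (V *\<^sub>v z)))"
    using U(1) A V(1) z by (simp add: mult_mat_smult_vec)
  finally have "A *\<^sub>v v = ?q \<cdot>\<^sub>v (A *\<^sub>v (V *\<^sub>v z))"
    using inj_mat_cancel[of U m m "A *\<^sub>v v"] inj_mat_square_iff_det[OF U(1)] U A V(1) z v by force
  then show ?thesis using V(1) z by (intro bexI[of _ "V *\<^sub>v z"]) auto
qed

text \<open>With \<open>N\<close> the entrywise conjugate of \<open>M\<close>, the square matrix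
  \<open>M\<^sup>T * N\<close> is nonsingular, because a complex vector of Hermitian norm 0 is zero.
  Its inverse yields the preimage.\<close>

lemma complex_transpose_surj:
  fixes M :: "complex mat"
  assumes M: "M \<in> carrier_mat m n" and inj: "inj_mat M" and c: "c \<in> carrier_vec n"
  shows "\<exists>v \<in> carrier_vec m. M\<^sup>T *\<^sub>v v = c"
proof -
  define N where "N = map_mat conjugate M"
  have N: "N \<in> carrier_mat m n" unfolding N_def using M by simp
  have NM: "N *\<^sub>v u = conjugate (M *\<^sub>v conjugate u)" if "u \<in> carrier_vec n" for u
    using M that unfolding N_def by (intro eq_vecI) (auto simp: scalar_prod_def)
  have G: "M\<^sup>T * N \<in> carrier_mat n n" using M N by simp
  have "inj_mat (M\<^sup>T * N)"
  proof (rule inj_matI[OF G])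
    fix u assume u: "u \<in> carrier_vec n" "(M\<^sup>T * N) *\<^sub>v u = 0\<^sub>v n"
    define z where "z = M *\<^sub>v conjugate u"
    have z: "z \<in> carrier_vec m" unfolding z_def using M u(1) by simp
    have "z \<bullet>c z = (N *\<^sub>v u) \<bullet> (M *\<^sub>v conjugate u)"
      unfolding NM[OF u(1)] z_def[symmetric] using z by (simp add: comm_scalar_prod[of _ m])
    also have "\<dots> = (M\<^sup>T *\<^sub>v (N *\<^sub>v u)) \<bullet> conjugate u"
      using transpose_vec_mult_scalar[OF M, of "conjugate u" "N *\<^sub>v u"] u(1) N by simp
    also have "M\<^sup>T *\<^sub>v (N *\<^sub>v u) = 0\<^sub>v n" using u M N by (simp add: assoc_mult_mat_vec[of _ n m _ n])
    finally have "z \<bullet>c z = 0" using u(1) by simp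
    then have "z = 0\<^sub>v m" using z by simp
    then show "u = 0\<^sub>v n" using inj_matD[OF inj M, of "conjugate u"] u(1) unfolding z_def by simp
  qed
  then have "det (M\<^sup>T * N) \<noteq> 0" using inj_mat_square_iff_det[OF G] by simp
  then obtain B where B: "B \<in> carrier_mat n n" "(M\<^sup>T * N) * B = 1\<^sub>m n"
    using field_right_inverse[OF G] by blast
  have "M\<^sup>T *\<^sub>v (N *\<^sub>v (B *\<^sub>v c)) = ((M\<^sup>T * N) * B) *\<^sub>v c"
    using M N B(1) c G by (simp add: assoc_mult_mat_vec[of _ n n _ n] assoc_mult_mat_vec[of _ n m _ n])
  then show ?thesis using B c N by (intro bexI[of _ "N *\<^sub>v (B *\<^sub>v c)"]) auto
qed

text \<open>A kernel vector c of E(\<alpha>) is written as the value at \<alpha> of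
  \<open>L\<^sup>T *\<^sub>v u\<close>. Then the product of the congruent matrix with u vanishes at
  \<alpha>; saturation and cancellation of L and E show that \<lambda> - \<alpha> divides
  \<open>L\<^sup>T *\<^sub>v u\<close>, so c is zero.\<close>

theorem congruence_eval_det:
  fixes L E :: "complex poly mat"
  assumes L: "L \<in> carrier_mat m n" and E: "E \<in> carrier_mat n n"
    and inj: "inj_mat (eval_mat L \<alpha>)" and detE: "det E \<noteq> 0"
    and ne: "\<not> finite_eigenvalue (L * E * L\<^sup>T) \<alpha>"
  shows "poly (det E) \<alpha> \<noteq> 0"
proof
  assume "poly (det E) \<alpha> = 0"
  then have "det (eval_mat E \<alpha>) = 0" by simp
  then obtain c where c: "c \<in> carrier_vec n" "c \<noteq> 0\<^sub>v n" "eval_mat E \<alpha> *\<^sub>v c = 0\<^sub>v n"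
    using det_0_iff_vec_prod_zero[of "eval_mat E \<alpha>" n] E by auto
  let ?q = "[:-\<alpha>, 1:]"
  let ?A = "L * E * L\<^sup>T"
  have A: "?A \<in> carrier_mat m m" using L E by simp
  have LT: "L\<^sup>T \<in> carrier_mat n m" using L by simp
  obtain v where v: "v \<in> carrier_vec m" "(eval_mat L \<alpha>)\<^sup>T *\<^sub>v v = c"
    using complex_transpose_surj[OF _ inj c(1), of m] L by auto
  \<comment> \<open>The constant lift of \<open>v\<close>, so that evaluation at \<alpha> gives
    \<open>v\<close> back.\<close>
  define u where "u = map_vec (\<lambda>a. [:a:]) v"
  have u: "u \<in> carrier_vec m" "eval_vec u \<alpha> = v" unfolding u_def using v(1) by (auto simp: vec_eq_iff)
  have Ax: "?A *\<^sub>v x = L *\<^sub>v (E *\<^sub>v (L\<^sup>T *\<^sub>v x))" if "x \<in> carrier_vec m" for x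
    using L E LT that by (simp add: assoc_mult_mat_vec[of _ m n _ m] assoc_mult_mat_vec[of _ m n _ n])
  have evLT: "eval_vec (L\<^sup>T *\<^sub>v u) \<alpha> = c"
    using poly_at.mult_mat_vec_hom[OF LT u(1), of \<alpha>] u(2) v(2) by (simp add: map_mat_transpose)
  have "eval_vec (?A *\<^sub>v u) \<alpha> = eval_mat L \<alpha> *\<^sub>v (eval_mat E \<alpha> *\<^sub>v c)"
    unfolding Ax[OF u(1)] using L E LT u(1) evLT
    by (subst poly_at.mult_mat_vec_hom[of _ m n], simp_all) (subst poly_at.mult_mat_vec_hom[of _ n n], simp_all)
  also have "\<dots> = 0\<^sub>v m" unfolding c(3) using L by auto
  finally obtain w where w: "w \<in> carrier_vec m" "?A *\<^sub>v u = ?q \<cdot>\<^sub>v (?A *\<^sub>v w)"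
    using not_eigenvalue_saturated[OF A ne u(1)] by blast
  have "L *\<^sub>v (E *\<^sub>v (L\<^sup>T *\<^sub>v u)) = L *\<^sub>v (E *\<^sub>v (?q \<cdot>\<^sub>v (L\<^sup>T *\<^sub>v w)))"
    using w(2) unfolding Ax[OF u(1)] Ax[OF w(1)]
    using mult_mat_smult_vec[OF E, of "L\<^sup>T *\<^sub>v w" ?q] mult_mat_smult_vec[OF L, of "E *\<^sub>v (L\<^sup>T *\<^sub>v w)" ?q] E LT w(1)
    by simp
  then have "E *\<^sub>v (L\<^sup>T *\<^sub>v u) = E *\<^sub>v (?q \<cdot>\<^sub>v (L\<^sup>T *\<^sub>v w))"
    using inj_mat_cancel[OF inj_mat_of_eval[OF L inj] L] E LT u(1) w(1) by simp
  then have "L\<^sup>T *\<^sub>v u = ?q \<cdot>\<^sub>v (L\<^sup>T *\<^sub>v w)"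
    using inj_mat_cancel[OF _ E] inj_mat_square_iff_det[OF E] detE LT u(1) w(1) by simp
  then have "c = 0\<^sub>v n"
    using evLT LT w(1) by (auto simp: vec_eq_iff)
  then show False using c(2) by simp
qed

subsection \<open>Bases of vector polynomials\<close>

interpretation to_fract_hom: inj_comm_ring_hom "to_fract :: 'a :: idom \<Rightarrow> 'a fract"
  by unfold_locales auto

text \<open>A maximal independent subset spans: an element outside its span could be added to
  it.\<close>

lemma (in vec_space) lin_indpt_subset_same_span:
  assumes S: "S \<subseteq> carrier_vec n" and fin: "finite S"
  shows "\<exists>T \<subseteq> S. lin_indpt T \<and> span T = span S"
proof -
  have ind0: "lin_indpt {}" unfolding lin_dep_def by auto
  have "\<exists>A. finite A \<and> maximal A (\<lambda>T. T \<subseteq> S \<and> lin_indpt T) \<and> {} \<subseteq> A"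
    by (rule maximal_exists_superset[OF fin]) (use ind0 in auto)
  then obtain T where "maximal T (\<lambda>T. T \<subseteq> S \<and> lin_indpt T)" by blast
  then have T: "T \<subseteq> S" "lin_indpt T" "\<And>B. T \<subseteq> B \<Longrightarrow> B \<subseteq> S \<Longrightarrow> lin_indpt B \<Longrightarrow> B = T"
    unfolding maximal_def by auto
  have "S \<subseteq> span T"
  proof
    fix s assume s: "s \<in> S"
    show "s \<in> span T"
    proof (rule ccontr)
      assume ns: "s \<notin> span T"
      have Tc: "T \<subseteq> carrier_vec n" using T(1) S by blast
      then have "s \<notin> T" using ns span_mem by auto
      then have "lin_indpt (T \<union> {s})"
        using lin_dep_iff_in_span[of T s] ns T(2) Tc s S by auto
      then show False using T(3)[of "T \<union> {s}"] T(1) s \<open>s \<notin> T\<close> by blast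
    qed
  qed
  then have "span S \<subseteq> span T" using span_subsetI[of T S] T(1) S by blast
  moreover have "span T \<subseteq> span S" using T(1) by (rule span_is_monotone)
  ultimately show ?thesis using T by blast
qed

section \<open>Passage from polynomial to rational matrices\<close>

lemma rat_mat_carrier [simp]: "rat_mat A \<in> carrier_mat m n \<longleftrightarrow> A \<in> carrier_mat m n"
  unfolding rat_mat_def by auto

lemma rat_vec_carrier [simp]: "rat_vec v \<in> carrier_vec n \<longleftrightarrow> v \<in> carrier_vec n"
  unfolding rat_vec_def carrier_vec_def by simp

lemma rat_mat_mult_vec:
  "A \<in> carrier_mat m n \<Longrightarrow> v \<in> carrier_vec n \<Longrightarrow> rat_mat A *\<^sub>v rat_vec v = rat_vec (A *\<^sub>v v)"
  unfolding rat_mat_def rat_vec_def by (simp add: to_fract_hom.mult_mat_vec_hom)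

lemma rat_mat_mult:
  "A \<in> carrier_mat m n \<Longrightarrow> B \<in> carrier_mat n q \<Longrightarrow> rat_mat (A * B) = rat_mat A * rat_mat B"
  unfolding rat_mat_def by (rule to_fract_hom.mat_hom_mult)

lemma inj_rat_vec: "inj rat_vec"
  unfolding rat_vec_def by (rule injI) (rule to_fract_hom.vec_hom_inj)

lemma inj_rat_mat: "inj rat_mat"
  unfolding rat_mat_def by (rule injI) (rule to_fract_hom.mat_hom_inj)

lemma cols_rat_mat: "cols (rat_mat A) = map rat_vec (cols A)"
  unfolding cols_def rat_mat_def rat_vec_def by auto

lemma distinct_cols_rat_mat: "distinct (cols (rat_mat A)) \<longleftrightarrow> distinct (cols A)"
  unfolding cols_rat_mat distinct_map using inj_rat_vec by (auto intro: inj_on_subset)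

lemma distinct_cols_of_inj_mat:
  fixes A :: "'a :: comm_ring_1 mat"
  assumes A: "A \<in> carrier_mat m n" and inj: "inj_mat A"
  shows "distinct (cols A)"
proof -
  have unit: "A *\<^sub>v unit_vec n i = col A i" if "i < n" for i
    using A that by (intro eq_vecI) auto
  have "i = j" if ij: "i < n" "j < n" "col A i = col A j" for i j
  proof (rule ccontr)
    assume "i \<noteq> j"
    have "unit_vec n i = (unit_vec n j :: 'a vec)"
      using inj_mat_cancel[OF inj A, of "unit_vec n i" "unit_vec n j"] unit ij by simp
    then show False using ij \<open>i \<noteq> j\<close> by simp
  qed
  then show ?thesis using A by (auto simp: distinct_conv_nth)
qed

lemma col_space_eq_range:
  assumes A: "(A :: 'a :: field mat) \<in> carrier_mat m n"
  shows "vec_space.col_space m A = {A *\<^sub>v w | w. w \<in> carrier_vec n}"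
proof -
  interpret vec_space "TYPE('a)" m .
  have "col_space A = {y \<in> carrier_vec m. \<exists>x \<in> carrier_vec n. A *\<^sub>v x = y}"
    using col_space_eq[OF A] A by simp
  also have "\<dots> = {A *\<^sub>v w | w. w \<in> carrier_vec n}"
  proof (intro Set.set_eqI iffI)
    fix y assume "y \<in> {A *\<^sub>v w | w. w \<in> carrier_vec n}"
    then obtain w where "w \<in> carrier_vec n" "y = A *\<^sub>v w" by blast
    then show "y \<in> {y \<in> carrier_vec m. \<exists>x \<in> carrier_vec n. A *\<^sub>v x = y}"
      using mult_mat_vec_carrier[OF A] by blast
  qed blast
  finally show ?thesis .
qed

text \<open>Translates independence and span of a list of vectors into the kernel and the image of
  one matrix. Distinctness of the list is absorbed, since two equal columns would give a kernel
  vector.\<close>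

lemma poly_basis_cols_iff:
  assumes L: "L \<in> carrier_mat m n"
  shows "poly_basis m V (cols L) \<longleftrightarrow>
           inj_mat (rat_mat L) \<and> V = {rat_mat L *\<^sub>v w | w. w \<in> carrier_vec n}"
proof -
  interpret vec_space "TYPE(complex poly fract)" m .
  have l: "rat_mat L \<in> carrier_mat m n" using L by simp
  have sc: "rat_vec ` set (cols L) = set (cols (rat_mat L))" unfolding cols_rat_mat by simp
  have sp: "span (set (cols (rat_mat L))) = {rat_mat L *\<^sub>v w | w. w \<in> carrier_vec n}"
    using col_space_eq_range[OF l] unfolding col_space_def .
  have ind: "distinct (cols L) \<and> lin_indpt (set (cols (rat_mat L))) \<longleftrightarrow> inj_mat (rat_mat L)"
  proof
    assume d: "distinct (cols L) \<and> lin_indpt (set (cols (rat_mat L)))"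
    show "inj_mat (rat_mat L)"
    proof (rule inj_matI[OF l])
      fix v assume "v \<in> carrier_vec n" "rat_mat L *\<^sub>v v = 0\<^sub>v m"
      then show "v = 0\<^sub>v n" using lin_depI[OF l] d distinct_cols_rat_mat by blast
    qed
  next
    assume i: "inj_mat (rat_mat L)"
    have d: "distinct (cols (rat_mat L))" by (rule distinct_cols_of_inj_mat[OF l i])
    have "lin_indpt (set (cols (rat_mat L)))"
      using lin_depE[OF l _ d] inj_matD[OF i l] by metis
    then show "distinct (cols L) \<and> lin_indpt (set (cols (rat_mat L)))"
      using d distinct_cols_rat_mat by blast
  qed
  have "set (cols L) \<subseteq> carrier_vec m" using L cols_dim by blast
  then show ?thesis
    unfolding poly_basis_def sc sp using ind eq_commute[of V] by meson
qed

lemma rat_col_space_eq: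
  assumes P: "P \<in> carrier_mat m q"
  shows "rat_col_space P = {rat_mat P *\<^sub>v w | w. w \<in> carrier_vec q}"
  unfolding rat_col_space_def using col_space_eq_range[of "rat_mat P" m q] P by simp

text \<open>The columns of \<open>P\<close> are polynomial already, so a maximal independent set of
  them serves. This makes the minimization of the degree sum one over a nonempty set.\<close>

lemma poly_basis_exists:
  assumes P: "P \<in> carrier_mat m q"
  shows "\<exists>bs. poly_basis m (rat_col_space P) bs"
proof -
  interpret vec_space "TYPE(complex poly fract)" m .
  have Pc: "set (cols P) \<subseteq> carrier_vec m" using P cols_dim by blast
  then have "set (cols (rat_mat P)) \<subseteq> carrier_vec m" unfolding cols_rat_mat by auto
  then obtain T where T: "T \<subseteq> set (cols (rat_mat P))" "lin_indpt T" "span T = span (set (cols (rat_mat P)))"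
    using lin_indpt_subset_same_span by blast
  have "set (cols (rat_mat P)) = rat_vec ` set (cols P)" unfolding cols_rat_mat by simp
  then obtain B where B: "B \<subseteq> set (cols P)" "T = rat_vec ` B" using T(1) by (metis subset_image_iff)
  have "finite B" using B(1) finite_subset by blast
  then obtain bs where bs: "set bs = B" "distinct bs" using finite_distinct_list by blast
  have "dim_row P = m" using P by simp
  then have "poly_basis m (rat_col_space P) bs"
    unfolding poly_basis_def rat_col_space_def using bs B T Pc by (auto simp: col_space_def)
  then show ?thesis by blast
qed

text \<open>Fixes the number of columns of the matrix formed from any polynomial basis, hence the
  shape of \<open>L\<close>.\<close>

lemma poly_basis_length:
  assumes P: "P \<in> carrier_mat m q" and bs: "poly_basis m (rat_col_space P) bs"
  shows "length bs = normal_rank P"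
proof -
  interpret vec_space "TYPE(complex poly fract)" m .
  have c: "set bs \<subseteq> carrier_vec m" and d: "distinct bs" and ind: "lin_indpt (rat_vec ` set bs)"
    and sp: "span (rat_vec ` set bs) = rat_col_space P"
    using bs unfolding poly_basis_def by auto
  define B where "B = rat_mat (mat_of_cols m bs)"
  have Bc: "B \<in> carrier_mat m (length bs)" unfolding B_def by simp
  have cB: "cols B = map rat_vec bs" unfolding B_def cols_rat_mat using c by simp
  have "distinct (cols B)" unfolding cB distinct_map using d inj_rat_vec by (auto intro: inj_on_subset)
  then have "rank B = length bs" using lin_indpt_full_rank[OF Bc] ind unfolding cB by simp
  moreover have "rank B = rank (rat_mat P)"
    using sp carrier_matD(1)[OF P] unfolding rank_def cB rat_col_space_def set_map
    by (simp add: vec_space.col_space_def)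
  ultimately show ?thesis unfolding normal_rank_def using P by simp
qed

lemma minimal_basis_exists:
  assumes P: "P \<in> carrier_mat m q"
  obtains L where "L \<in> carrier_mat m (normal_rank P)" and "minimal_basis m (rat_col_space P) (cols L)"
proof -
  let ?V = "rat_col_space P"
  let ?deg = "\<lambda>bs. sum_list (map vec_degree bs)"
  obtain bs where bs: "poly_basis m ?V bs" "\<And>bs'. poly_basis m ?V bs' \<Longrightarrow> ?deg bs \<le> ?deg bs'"
    using poly_basis_exists[OF P] ex_has_least_nat[of "poly_basis m ?V" _ ?deg] by blast
  have "cols (mat_of_cols m bs) = bs" using bs(1) unfolding poly_basis_def by simp
  moreover have "mat_of_cols m bs \<in> carrier_mat m (normal_rank P)"
    unfolding poly_basis_length[OF P bs(1), symmetric] by (rule mat_of_cols_carrier(1))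
  moreover have "minimal_basis m ?V bs" using bs unfolding minimal_basis_def by blast
  ultimately show ?thesis using that[of "mat_of_cols m bs"] by simp
qed

section \<open>Degrees of vector polynomials and the exchange argument\<close>

lemma degree_le_vec_degree:
  assumes "i < dim_vec v"
  shows "degree (v $ i) \<le> vec_degree v"
proof (cases "v $ i = 0")
  case False
  let ?S = "{k. vec_coeff v k \<noteq> 0\<^sub>v (dim_vec v)}"
  \<comment> \<open>\<open>Max\<close> is meaningful only for finite sets, so finiteness has to be
    shown before the bound.\<close>
  have "?S \<subseteq> (\<Union>i<dim_vec v. {..degree (v $ i)})"
  proof
    fix k assume "k \<in> ?S"
    then obtain i where "i < dim_vec v" "coeff (v $ i) k \<noteq> 0"
      by (auto simp: vec_coeff_def vec_eq_iff)
    then show "k \<in> (\<Union>i<dim_vec v. {..degree (v $ i)})" using le_degree by blast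
  qed
  then have "finite ?S" by (rule finite_subset) auto
  moreover have "vec_coeff v (degree (v $ i)) $ i \<noteq> 0"
    using assms False by (simp add: vec_coeff_def)
  then have "degree (v $ i) \<in> ?S" using assms by auto
  ultimately show ?thesis unfolding vec_degree_def by (intro Max_ge) auto
qed simp

lemma vec_degree_leI:
  assumes "\<And>i. i < dim_vec v \<Longrightarrow> degree (v $ i) \<le> d"
  shows "vec_degree v \<le> d"
proof -
  let ?S = "{k. vec_coeff v k \<noteq> 0\<^sub>v (dim_vec v)}"
  have sub: "?S \<subseteq> {..d}"
  proof
    fix k assume "k \<in> ?S"
    then obtain i where i: "i < dim_vec v" "coeff (v $ i) k \<noteq> 0"
      by (auto simp: vec_coeff_def vec_eq_iff)
    then show "k \<in> {..d}" using le_degree[of "v $ i" k] assms[of i] by simp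
  qed
  then have "finite ?S" by (rule finite_subset) auto
  then show ?thesis unfolding vec_degree_def using sub by (intro Max.boundedI) auto
qed

text \<open>A column of a minimal basis that enters a rational combination \<open>x\<close> may be exchanged for \<open>x\<close>,
  so \<open>x\<close> cannot have smaller degree.\<close>

lemma minimal_basis_exchange:
  assumes L: "L \<in> carrier_mat m n" and min: "minimal_basis m V (cols L)"
    and c: "c \<in> carrier_vec n" and j: "j < n" "c $ j \<noteq> 0"
    and x: "x \<in> carrier_vec m" "rat_vec x = rat_mat L *\<^sub>v c"
  shows "\<exists>i<m. x $ i \<noteq> 0 \<and> vec_degree (col L j) \<le> degree (x $ i)"
proof (rule ccontr)
  assume neg: "\<not> ?thesis"
  let ?l = "rat_mat L"
  have l: "?l \<in> carrier_mat m n" using L by simp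
  have inj: "inj_mat ?l" and V: "V = {?l *\<^sub>v w | w. w \<in> carrier_vec n}"
    using min poly_basis_cols_iff[OF L] unfolding minimal_basis_def by blast+
  have "rat_vec x \<noteq> 0\<^sub>v m"
  proof
    assume "rat_vec x = 0\<^sub>v m"
    then have "c = 0\<^sub>v n" using inj_matD[OF inj l c] x(2) by simp
    then show False using j by simp
  qed
  then have "x \<noteq> 0\<^sub>v m" unfolding rat_vec_def by auto
  then obtain i where i: "i < m" "x $ i \<noteq> 0" using x(1) by (auto simp: vec_eq_iff)
  \<comment> \<open>Zero entries of \<open>x\<close> have degree 0 by convention; positivity of the
    degree of column j makes the comparison strict for them as well.\<close>
  then have pos: "0 < vec_degree (col L j)" using neg by (auto simp: not_le)
  have xdeg: "vec_degree x < vec_degree (col L j)"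
  proof -
    have "degree (x $ i) \<le> vec_degree (col L j) - 1" if "i < dim_vec x" for i
      using neg that pos x(1) by (cases "x $ i = 0") force+
    then have "vec_degree x \<le> vec_degree (col L j) - 1" by (rule vec_degree_leI)
    then show ?thesis using pos by simp
  qed
  define L' where "L' = mat m n (\<lambda>(i, k). if k = j then x $ i else L $$ (i, k))"
  have L': "L' \<in> carrier_mat m n" unfolding L'_def by simp
  \<comment> \<open>The change of coordinates: combining the columns of \<open>L'\<close> with
    \<open>w\<close> is combining those of \<open>L\<close> with \<open>\<phi> w\<close>, because
    column j was replaced by the combination with coefficients \<open>c\<close>.\<close>
  define \<phi> where "\<phi> w = vec n (\<lambda>i. (if i = j then 0 else w $ i) + w $ j * c $ i)" for w
  have \<phi>c: "\<phi> w \<in> carrier_vec n" for w unfolding \<phi>_def by simp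
  have \<phi>: "rat_mat L' *\<^sub>v w = ?l *\<^sub>v \<phi> w" if w: "w \<in> carrier_vec n" for w
  proof (rule eq_vecI)
    fix i assume "i < dim_vec (?l *\<^sub>v \<phi> w)"
    then have i: "i < m" using l by simp
    have xi: "to_fract (x $ i) = (\<Sum>k = 0..<n. ?l $$ (i, k) * c $ k)"
    proof -
      have "to_fract (x $ i) = rat_vec x $ i" using x(1) i by (simp add: rat_vec_def)
      then show ?thesis unfolding x(2) using l i c by (simp add: scalar_prod_def)
    qed
    have "(rat_mat L' *\<^sub>v w) $ i = (\<Sum>k = 0..<n. rat_mat L' $$ (i, k) * w $ k)"
      using L' w i by (simp add: scalar_prod_def rat_mat_def)
    also have "\<dots> = (\<Sum>k = 0..<n. (if k = j then to_fract (x $ i) * w $ j else 0) + ?l $$ (i, k) * (if k = j then 0 else w $ k))"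
      using i L by (intro sum.cong) (auto simp: L'_def rat_mat_def)
    also have "\<dots> = to_fract (x $ i) * w $ j + (\<Sum>k = 0..<n. ?l $$ (i, k) * (if k = j then 0 else w $ k))"
      using j by (simp add: sum.distrib)
    also have "\<dots> = (\<Sum>k = 0..<n. ?l $$ (i, k) * \<phi> w $ k)"
      unfolding xi sum_distrib_right sum.distrib[symmetric] \<phi>_def
      by (intro sum.cong) (auto simp: algebra_simps)
    also have "\<dots> = (?l *\<^sub>v \<phi> w) $ i"
      using l i by (simp add: scalar_prod_def \<phi>_def)
    finally show "(rat_mat L' *\<^sub>v w) $ i = (?l *\<^sub>v \<phi> w) $ i" .
  qed (use l L' in \<open>simp add: rat_mat_def\<close>)
  have "inj_mat (rat_mat L')"
  proof (rule inj_matI[of _ m n])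
    fix w assume w: "w \<in> carrier_vec n" "rat_mat L' *\<^sub>v w = 0\<^sub>v m"
    then have *: "\<phi> w = 0\<^sub>v n" using inj_matD[OF inj l \<phi>c] \<phi> by simp
    have **: "\<phi> w $ i = 0" if "i < n" for i unfolding * using that by simp
    then have wj: "w $ j = 0" using j by (force simp: \<phi>_def)
    have "w $ i = 0" if "i < n" for i
      using **[OF that] wj that by (cases "i = j") (auto simp: \<phi>_def)
    then show "w = 0\<^sub>v n" using w(1) by (auto simp: vec_eq_iff)
  qed (use L' in simp)
  moreover have "V = {rat_mat L' *\<^sub>v w | w. w \<in> carrier_vec n}"
  proof
    show "V \<subseteq> {rat_mat L' *\<^sub>v w | w. w \<in> carrier_vec n}"
    proof
      fix y assume "y \<in> V"
      then obtain w where w: "w \<in> carrier_vec n" "y = ?l *\<^sub>v w" unfolding V by blast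
      \<comment> \<open>The preimage of \<open>w\<close> under \<phi>; it exists because
        \<open>c $ j\<close> is nonzero.\<close>
      define u where "u = vec n (\<lambda>i. if i = j then w $ j / c $ j else w $ i - w $ j / c $ j * c $ i)"
      have u: "u \<in> carrier_vec n" unfolding u_def by simp
      have "\<phi> u = w"
        using w(1) j by (intro eq_vecI) (auto simp: \<phi>_def u_def)
      then have "y = rat_mat L' *\<^sub>v u" using \<phi>[OF u] w(2) by simp
      then show "y \<in> {rat_mat L' *\<^sub>v w | w. w \<in> carrier_vec n}" using u by blast
    qed
    show "{rat_mat L' *\<^sub>v w | w. w \<in> carrier_vec n} \<subseteq> V" unfolding V using \<phi> \<phi>c by auto
  qed
  ultimately have "poly_basis m V (cols L')" using poly_basis_cols_iff[OF L'] by blast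
  then have "sum_list (map vec_degree (cols L)) \<le> sum_list (map vec_degree (cols L'))"
    using min unfolding minimal_basis_def by blast
  then have "(\<Sum>k = 0..<n. vec_degree (col L k)) \<le> (\<Sum>k = 0..<n. vec_degree (col L' k))"
    using L L' by (simp add: sum_list_sum_nth)
  moreover have "(\<Sum>k = 0..<n. vec_degree (col L' k)) < (\<Sum>k = 0..<n. vec_degree (col L k))"
  proof (rule sum_strict_mono_ex1)
    have "col L' k = col L k" if "k < n" "k \<noteq> j" for k
      using that L unfolding L'_def by (auto simp: vec_eq_iff)
    moreover have cj: "col L' j = x" unfolding L'_def using j x(1) by (auto simp: vec_eq_iff)
    ultimately show "\<forall>k\<in>{0..<n}. vec_degree (col L' k) \<le> vec_degree (col L k)"
      using xdeg by (metis atLeastLessThan_iff order.refl less_imp_le)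
    show "\<exists>k\<in>{0..<n}. vec_degree (col L' k) < vec_degree (col L k)"
      using cj xdeg j by (intro bexI[of _ j]) auto
  qed simp
  ultimately show False by simp
qed

subsection \<open>Minimal bases and the skew-symmetric factorization\<close>

text \<open>Selects the column to be exchanged: one of largest degree among those that really occur
  in the combination.\<close>

lemma nonzero_vec_max_support:
  fixes d :: "nat \<Rightarrow> nat"
  assumes "c \<in> carrier_vec n" and "c \<noteq> 0\<^sub>v n"
  shows "\<exists>j<n. c $ j \<noteq> 0 \<and> (\<forall>k<n. c $ k \<noteq> 0 \<longrightarrow> d k \<le> d j)"
proof -
  let ?S = "{k. k < n \<and> c $ k \<noteq> 0}"
  have "?S \<noteq> {}" using assms by (auto simp: vec_eq_iff)
  moreover have "finite ?S" by simp
  ultimately have "Max (d ` ?S) \<in> d ` ?S" and "\<And>k. k \<in> ?S \<Longrightarrow> d k \<le> Max (d ` ?S)"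
    by (auto intro!: Max_in Max_ge)
  then obtain j where "j \<in> ?S" and "\<And>k. k \<in> ?S \<Longrightarrow> d k \<le> d j"
    by (metis (no_types, lifting) imageE)
  then show ?thesis by blast
qed

lemma degree_entry_le_vec_degree_col:
  "L \<in> carrier_mat m n \<Longrightarrow> i < m \<Longrightarrow> k < n \<Longrightarrow> degree (L $$ (i, k)) \<le> vec_degree (col L k)"
  using degree_le_vec_degree[of i "col L k"] by auto

text \<open>A kernel vector c of L(\<alpha>) makes the combination of columns with the constants c
  divisible by \<lambda> - \<alpha>. The quotient is a vector polynomial in V whose degree lies
  below the largest column degree used, which the exchange lemma forbids.\<close>

theorem minimal_basis_inj_eval:
  assumes L: "L \<in> carrier_mat m n" and min: "minimal_basis m V (cols L)"
  shows "inj_mat (eval_mat L \<alpha>)"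
proof (rule inj_matI[of _ m n], use L in simp, rule ccontr)
  fix c assume c: "c \<in> carrier_vec n" "eval_mat L \<alpha> *\<^sub>v c = 0\<^sub>v m" "c \<noteq> 0\<^sub>v n"
  let ?d = "\<lambda>k. vec_degree (col L k)"
  let ?q = "[:-\<alpha>, 1:]"
  obtain j where j: "j < n" "c $ j \<noteq> 0" "\<And>k. k < n \<Longrightarrow> c $ k \<noteq> 0 \<Longrightarrow> ?d k \<le> ?d j"
    using nonzero_vec_max_support[OF c(1,3), of ?d] by metis
  define u where "u = map_vec (\<lambda>a. [:a:]) c"
  have u: "u \<in> carrier_vec n" "eval_vec u \<alpha> = c" unfolding u_def using c(1) by (auto simp: vec_eq_iff)
  define y where "y = L *\<^sub>v u"
  have y: "y \<in> carrier_vec m" unfolding y_def using L u by simp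
  have "eval_vec y \<alpha> = 0\<^sub>v m"
    unfolding y_def using poly_at.mult_mat_vec_hom[OF L u(1), of \<alpha>] u(2) c(2) by simp
  then obtain x where x: "x \<in> carrier_vec m" "y = ?q \<cdot>\<^sub>v x"
    using smult_vec_factor[OF y] eval_vec_eq_0_iff[OF y] by metis
  have ydeg: "degree (y $ i) \<le> ?d j" if "i < m" for i
  proof -
    have "y $ i = (\<Sum>k = 0..<n. L $$ (i, k) * [:c $ k:])"
      unfolding y_def using L u c(1) that by (simp add: scalar_prod_def u_def)
    moreover have "degree (L $$ (i, k) * [:c $ k:]) \<le> ?d j" if k: "k < n" for k
    proof (cases "c $ k = 0")
      case False
      have "degree (L $$ (i, k) * [:c $ k:]) \<le> degree (L $$ (i, k))"
        using degree_mult_le[of "L $$ (i, k)" "[:c $ k:]"] by simp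
      then show ?thesis
        using degree_entry_le_vec_degree_col[OF L \<open>i < m\<close> k] j(3)[OF k False] by linarith
    qed simp
    ultimately show ?thesis by (auto intro!: degree_sum_le)
  qed
  \<comment> \<open>The rational coordinates of the quotient \<open>x\<close> with respect to the
    columns of \<open>L\<close>.\<close>
  define c' where "c' = inverse (to_fract ?q) \<cdot>\<^sub>v rat_vec u"
  have rq: "to_fract ?q \<noteq> 0" by (simp del: to_fract_def)
  have c': "c' \<in> carrier_vec n" unfolding c'_def using u(1) by simp
  have c'j: "c' $ j \<noteq> 0"
    unfolding c'_def rat_vec_def u_def using j c(1) rq by auto
  have "rat_mat L *\<^sub>v c' = inverse (to_fract ?q) \<cdot>\<^sub>v rat_vec y"
    unfolding c'_def y_def using L u(1) by (subst mult_mat_smult_vec[of _ m n]) (auto simp: rat_mat_mult_vec)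
  also have "rat_vec y = to_fract ?q \<cdot>\<^sub>v rat_vec x"
    unfolding x(2) rat_vec_def by (rule to_fract_hom.vec_hom_smult)
  also have "inverse (to_fract ?q) \<cdot>\<^sub>v (to_fract ?q \<cdot>\<^sub>v rat_vec x) = rat_vec x"
    using rq by (simp only: smult_smult_assoc left_inverse) simp
  finally obtain i where i: "i < m" "x $ i \<noteq> 0" "?d j \<le> degree (x $ i)"
    using minimal_basis_exchange[OF L min c' j(1) c'j x(1)] by auto
  have "degree (y $ i) = Suc (degree (x $ i))"
    unfolding x(2) using i x(1) by (simp only: index_smult_vec carrier_vecD) (subst degree_mult_eq, auto)
  then show False using ydeg[OF i(1)] i(3) by simp
qed

text \<open>The leading column coefficient matrix; \<open>L\<close> is called column reduced when
  this matrix has full column rank. It is also the value at 0 of \<open>L\<close> with each column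
  reversed at its own degree.\<close>

definition lead_mat :: "complex poly mat \<Rightarrow> complex mat" where
  "lead_mat L = mat (dim_row L) (dim_col L) (\<lambda>(i, k). coeff (L $$ (i, k)) (vec_degree (col L k)))"

text \<open>The analogue at infinity: a kernel vector gives a combination of shifted columns in
  which the leading terms cancel, so again the degree drops below that of a column used.\<close>

theorem minimal_basis_inj_lead:
  assumes L: "L \<in> carrier_mat m n" and min: "minimal_basis m V (cols L)"
  shows "inj_mat (lead_mat L)"
proof (rule inj_matI[of _ m n], use L in \<open>simp add: lead_mat_def\<close>, rule ccontr)
  fix c assume c: "c \<in> carrier_vec n" "lead_mat L *\<^sub>v c = 0\<^sub>v m" "c \<noteq> 0\<^sub>v n"
  let ?d = "\<lambda>k. vec_degree (col L k)"
  obtain j where j: "j < n" "c $ j \<noteq> 0" "\<And>k. k < n \<Longrightarrow> c $ k \<noteq> 0 \<Longrightarrow> ?d k \<le> ?d j"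
    using nonzero_vec_max_support[OF c(1,3), of ?d] by metis
  \<comment> \<open>The shifts lift every column in the support of \<open>c\<close> to the degree of
    column j. Truncated subtraction matters only where \<open>c\<close> is zero, and there the
    monomial is zero.\<close>
  define u where "u = vec n (\<lambda>k. monom (c $ k) (?d j - ?d k))"
  have u: "u \<in> carrier_vec n" unfolding u_def by simp
  define x where "x = L *\<^sub>v u"
  have x: "x \<in> carrier_vec m" unfolding x_def using L u by simp
  have xi: "x $ i = (\<Sum>k = 0..<n. L $$ (i, k) * monom (c $ k) (?d j - ?d k))" if "i < m" for i
    unfolding x_def using L u that by (simp add: scalar_prod_def u_def)
  have term_deg: "degree (L $$ (i, k) * monom (c $ k) (?d j - ?d k)) \<le> ?d j" if "i < m" "k < n" for i k
  proof (cases "c $ k = 0")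
    case False
    have "degree (L $$ (i, k) * monom (c $ k) (?d j - ?d k)) \<le> degree (L $$ (i, k)) + (?d j - ?d k)"
      using degree_mult_le[of "L $$ (i, k)" "monom (c $ k) (?d j - ?d k)"] degree_monom_le[of "c $ k" "?d j - ?d k"]
      by linarith
    then show ?thesis
      using degree_entry_le_vec_degree_col[OF L that] j(3)[OF that(2) False] by linarith
  qed simp
  have term_coeff: "coeff (L $$ (i, k) * monom (c $ k) (?d j - ?d k)) (?d j) = lead_mat L $$ (i, k) * c $ k"
    if "i < m" "k < n" for i k
  proof (cases "c $ k = 0")
    case False
    then have "?d j - (?d j - ?d k) = ?d k" using j(3)[OF that(2) False] by simp
    then show ?thesis
      using that L by (simp add: lead_mat_def mult.commute[of "L $$ (i, k)"] coeff_monom_mult)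
  qed simp
  have "degree (x $ i) < ?d j" if i: "i < m" "x $ i \<noteq> 0" for i
  proof -
    have "degree (x $ i) \<le> ?d j" unfolding xi[OF i(1)] using term_deg[OF i(1)] by (auto intro!: degree_sum_le)
    moreover have "coeff (x $ i) (?d j) = (lead_mat L *\<^sub>v c) $ i"
      unfolding xi[OF i(1)] coeff_sum
      using term_coeff[OF i(1)] i(1) L c(1) by (simp add: scalar_prod_def lead_mat_def)
    then have "coeff (x $ i) (?d j) = 0" using c(2) i by simp
    ultimately show ?thesis using i(2) by (metis leading_coeff_0_iff le_neq_implies_less)
  qed
  moreover have "rat_vec x = rat_mat L *\<^sub>v rat_vec u" unfolding x_def using rat_mat_mult_vec[OF L u] by simp
  moreover have "rat_vec u $ j \<noteq> 0" using j by (simp add: rat_vec_def u_def)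
  ultimately show False
    using minimal_basis_exchange[OF L min _ j(1) _ x, of "rat_vec u"] u by fastforce
qed

section \<open>Polynomial solutions of linear systems over the rational functions\<close>

lemma mat_eq_of_cols:
  assumes "A \<in> carrier_mat m n" "B \<in> carrier_mat m n" "\<And>k. k < n \<Longrightarrow> col A k = col B k"
  shows "A = B"
  using assms by (intro mat_col_eqI) auto

lemma mat_solve_cols:
  assumes A: "A \<in> carrier_mat m n" and C: "C \<in> carrier_mat m q"
    and ex: "\<And>k. k < q \<Longrightarrow> \<exists>w \<in> carrier_vec n. A *\<^sub>v w = col C k"
  obtains W where "W \<in> carrier_mat n q" and "A * W = C"
proof -
  from ex have "\<forall>k. \<exists>w. k < q \<longrightarrow> w \<in> carrier_vec n \<and> A *\<^sub>v w = col C k" by blast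
  then obtain f where f: "\<And>k. k < q \<Longrightarrow> f k \<in> carrier_vec n \<and> A *\<^sub>v f k = col C k" by metis
  define W where "W = mat n q (\<lambda>(i, k). f k $ i)"
  have W: "W \<in> carrier_mat n q" unfolding W_def by simp
  have "col W k = f k" if "k < q" for k
    unfolding W_def using f[OF that] that by (auto simp: vec_eq_iff)
  then have "col (A * W) k = col C k" if "k < q" for k
    using col_mult2[OF A W that] f[OF that] that by simp
  then have "A * W = C" using A C W by (intro mat_eq_of_cols[of _ m q]) auto
  then show ?thesis using that W by blast
qed

lemma inj_mat_mult_cancel:
  fixes A :: "'a :: comm_ring_1 mat"
  assumes A: "inj_mat A" "A \<in> carrier_mat m n" and B: "B \<in> carrier_mat n q" and C: "C \<in> carrier_mat n q"
    and eq: "A * B = A * C"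
  shows "B = C"
proof (rule mat_eq_of_cols[OF B C])
  fix k assume k: "k < q"
  have "A *\<^sub>v col B k = A *\<^sub>v col C k"
    using eq col_mult2[OF A(2) B k] col_mult2[OF A(2) C k] by metis
  then show "col B k = col C k" using inj_mat_cancel[OF A, of "col B k" "col C k"] B C k by simp
qed

lemma common_denominator:
  fixes w :: "'a :: idom fract vec"
  assumes w: "w \<in> carrier_vec n"
  obtains q u where "q \<noteq> 0" and "u \<in> carrier_vec n" and "to_fract q \<cdot>\<^sub>v w = map_vec to_fract u"
proof -
  have "\<forall>i. \<exists>a b. w $ i = Fraction_Field.Fract a b \<and> b \<noteq> 0" using Fract_cases by metis
  then obtain a b where ab: "\<And>i. w $ i = Fraction_Field.Fract (a i) (b i)" "\<And>i. b i \<noteq> 0" by metis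
  define q where "q = (\<Prod>i<n. b i)"
  define u where "u = vec n (\<lambda>i. a i * (\<Prod>k \<in> {..<n} - {i}. b k))"
  have "to_fract q * w $ i = to_fract (u $ i)" if "i < n" for i
  proof -
    have "q = b i * (\<Prod>k \<in> {..<n} - {i}. b k)"
      unfolding q_def using that by (simp add: prod.remove)
    then show ?thesis using that ab(2)[of i] by (simp add: ab(1) u_def to_fract_def eq_fract)
  qed
  then have "to_fract q \<cdot>\<^sub>v w = map_vec to_fract u" using w by (intro eq_vecI) (auto simp: u_def)
  moreover have "q \<noteq> 0" unfolding q_def using ab(2) by simp
  moreover have "u \<in> carrier_vec n" unfolding u_def by simp
  ultimately show ?thesis using that by blast
qed

text \<open>After a common denominator q is cleared, q divides the image of the numerator vector u;
  full rank of \<open>L\<close> at all roots of q lets q be divided out of u.\<close>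

lemma rational_solution_is_polynomial:
  assumes L: "L \<in> carrier_mat m n" and inj: "\<And>\<alpha>. inj_mat (eval_mat L \<alpha>)"
    and w: "w \<in> carrier_vec n" and x: "x \<in> carrier_vec m" and eq: "rat_mat L *\<^sub>v w = rat_vec x"
  shows "\<exists>u \<in> carrier_vec n. w = rat_vec u"
proof -
  obtain q u where q: "q \<noteq> 0" and u: "u \<in> carrier_vec n" and qu: "to_fract q \<cdot>\<^sub>v w = rat_vec u"
    unfolding rat_vec_def using common_denominator[OF w] .
  have "rat_vec (L *\<^sub>v u) = rat_mat L *\<^sub>v (to_fract q \<cdot>\<^sub>v w)" using rat_mat_mult_vec[OF L u] qu by simp
  also have "\<dots> = to_fract q \<cdot>\<^sub>v rat_vec x" using mult_mat_smult_vec[of "rat_mat L" m n w] L w eq by simp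
  also have "\<dots> = rat_vec (q \<cdot>\<^sub>v x)" unfolding rat_vec_def by (rule to_fract_hom.vec_hom_smult[symmetric])
  finally have "L *\<^sub>v u = q \<cdot>\<^sub>v x" by (rule injD[OF inj_rat_vec])
  then obtain v where v: "v \<in> carrier_vec n" "u = q \<cdot>\<^sub>v v"
    using dvd_mult_mat_vecD[OF L u q inj] x by fastforce
  have "rat_vec u = to_fract q \<cdot>\<^sub>v rat_vec v" unfolding v(2) rat_vec_def by (rule to_fract_hom.vec_hom_smult)
  then have *: "to_fract q \<cdot>\<^sub>v w = to_fract q \<cdot>\<^sub>v rat_vec v" using qu by simp
  have "w = rat_vec v"
  proof (rule eq_vecI)
    fix i assume "i < dim_vec (rat_vec v)"
    then have "i < n" using v(1) by (simp add: rat_vec_def)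
    then have "to_fract q * w $ i = to_fract q * rat_vec v $ i"
      using arg_cong[OF *, of "\<lambda>z. z $ i"] w v(1) by (simp add: rat_vec_def)
    then show "w $ i = rat_vec v $ i" using q by simp
  qed (use w v(1) in \<open>simp add: rat_vec_def\<close>)
  then show ?thesis using v(1) by blast
qed

lemma rational_solution_mat_is_polynomial:
  assumes L: "L \<in> carrier_mat m n" and inj: "\<And>\<alpha>. inj_mat (eval_mat L \<alpha>)"
    and W: "W \<in> carrier_mat n q" and C: "C \<in> carrier_mat m q" and eq: "rat_mat L * W = rat_mat C"
  shows "\<exists>U \<in> carrier_mat n q. W = rat_mat U \<and> L * U = C"
proof -
  have "\<exists>u \<in> carrier_vec n. col W k = rat_vec u" if k: "k < q" for k
  proof (rule rational_solution_is_polynomial[OF L inj])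
    show "rat_mat L *\<^sub>v col W k = rat_vec (col C k)"
      using arg_cong[OF eq, of "\<lambda>M. col M k"] L W C k col_mult2[of "rat_mat L" m n W q k]
      by (simp add: rat_mat_def rat_vec_def)
  qed (use W C k in auto)
  then have "\<forall>k. \<exists>u. k < q \<longrightarrow> u \<in> carrier_vec n \<and> col W k = rat_vec u" by blast
  then obtain f where f: "\<And>k. k < q \<Longrightarrow> f k \<in> carrier_vec n \<and> col W k = rat_vec (f k)" by metis
  define U where "U = mat n q (\<lambda>(i, k). f k $ i)"
  have U: "U \<in> carrier_mat n q" unfolding U_def by simp
  have "col U k = f k" if "k < q" for k
    unfolding U_def using f[OF that] that by (auto simp: vec_eq_iff)
  then have WU: "W = rat_mat U"
    using W U f by (intro mat_eq_of_cols[of _ n q]) (auto simp: rat_mat_def rat_vec_def)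
  have "rat_mat (L * U) = rat_mat C" using rat_mat_mult[OF L U] eq WU by simp
  then have "L * U = C" by (rule injD[OF inj_rat_mat])
  then show ?thesis using U WU by blast
qed

lemma normal_rank_square_iff:
  assumes E: "E \<in> carrier_mat n n"
  shows "normal_rank E = n \<longleftrightarrow> det E \<noteq> 0"
proof -
  interpret vec_space "TYPE(complex poly fract)" n .
  have "det (rat_mat E) = to_fract (det E)" unfolding rat_mat_def by simp
  then show ?thesis
    using det_rank_iff[of "rat_mat E"] E unfolding normal_rank_def by auto
qed

lemma POL_ss_skew:
  assumes "P \<in> POL_ss d k m"
  shows "P \<in> carrier_mat m m" and "P\<^sup>T = - P"
proof -
  show P: "P \<in> carrier_mat m m" using assms unfolding POL_ss_def by blast
  have "P $$ (j, i) = - P $$ (i, j)" if "i < m" "j < m" for i j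
  proof (rule poly_eqI)
    fix k
    have "(mat_coeff P k)\<^sup>T = - mat_coeff P k"
      using assms unfolding POL_ss_def skew_symmetric_mat_def by blast
    then have "(mat_coeff P k)\<^sup>T $$ (i, j) = (- mat_coeff P k) $$ (i, j)" by simp
    then show "coeff (P $$ (j, i)) k = coeff (- P $$ (i, j)) k"
      using P that by (simp add: mat_coeff_def)
  qed
  note entry = this
  show "P\<^sup>T = - P"
  proof (rule eq_matI)
    fix i j assume "i < dim_row (- P)" "j < dim_col (- P)"
    then show "P\<^sup>T $$ (i, j) = (- P) $$ (i, j)" using P entry[of i j] by simp
  qed (use P in auto)
qed

theorem skew_factorization_exists:
  assumes P: "P \<in> carrier_mat m m" "P\<^sup>T = - P" and rk: "normal_rank P = 2 * r"
  shows "\<exists>L E. skew_factorization m r P L E"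
proof -
  define n where "n = 2 * r"
  obtain L where L: "L \<in> carrier_mat m n" and min: "minimal_basis m (rat_col_space P) (cols L)"
    using minimal_basis_exists[OF P(1)] rk unfolding n_def by metis
  let ?l = "rat_mat L" and ?p = "rat_mat P"
  have l: "?l \<in> carrier_mat m n" and p: "?p \<in> carrier_mat m m" using L P by simp_all
  have injl: "inj_mat ?l" and range: "{?p *\<^sub>v w | w. w \<in> carrier_vec m} = {?l *\<^sub>v w | w. w \<in> carrier_vec n}"
    using min poly_basis_cols_iff[OF L] rat_col_space_eq[OF P(1)] unfolding minimal_basis_def by auto
  have inj: "inj_mat (eval_mat L \<alpha>)" for \<alpha> by (rule minimal_basis_inj_eval[OF L min])
  have unit: "A *\<^sub>v unit_vec q k = col A k" if "A \<in> carrier_mat m q" "k < q"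
    for A :: "complex poly fract mat" and q k
    using that by (intro eq_vecI) auto
  have "\<exists>w \<in> carrier_vec n. ?l *\<^sub>v w = col ?p k" if "k < m" for k
  proof -
    have "col ?p k \<in> {?p *\<^sub>v w | w. w \<in> carrier_vec m}"
      using unit[OF p that, symmetric] unit_vec_carrier[of m k] by blast
    then show ?thesis unfolding range by force
  qed
  then obtain W where W: "W \<in> carrier_mat n m" "?l * W = ?p" using mat_solve_cols[OF l p] by blast
  then obtain R where R: "R \<in> carrier_mat n m" "W = rat_mat R" "L * R = P"
    using rational_solution_mat_is_polynomial[OF L inj W(1) P(1)] by blast
  have "\<exists>w \<in> carrier_vec m. ?p *\<^sub>v w = col ?l k" if "k < n" for k
  proof -
    have "col ?l k \<in> {?l *\<^sub>v w | w. w \<in> carrier_vec n}"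
      using unit[OF l that, symmetric] unit_vec_carrier[of n k] by blast
    then show ?thesis unfolding range[symmetric] by force
  qed
  then obtain Y where Y: "Y \<in> carrier_mat m n" "?p * Y = ?l" using mat_solve_cols[OF p l] by blast
  \<comment> \<open>From \<open>?p = - (W\<^sup>T * ?l\<^sup>T)\<close> and
    \<open>?p * Y = ?l\<close> it follows that \<open>?l = W\<^sup>T * M\<close>. Since
    \<open>?l\<close> has trivial kernel, so has the square matrix \<open>M\<close>, and its inverse
    expresses \<open>W\<^sup>T\<close> through \<open>?l\<close>.\<close>
  define M where "M = - (?l\<^sup>T * Y)"
  have M: "M \<in> carrier_mat n n" unfolding M_def using l Y(1) by simp
  have WT: "W\<^sup>T \<in> carrier_mat m n" using W(1) by simp
  have "?p = - ?p\<^sup>T"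
  proof -
    have "?p\<^sup>T = rat_mat P\<^sup>T" unfolding rat_mat_def by (rule map_mat_transpose)
    also have "\<dots> = - ?p" unfolding P(2) rat_mat_def by (rule eq_matI) auto
    finally show ?thesis by simp
  qed
  also have "?p\<^sup>T = W\<^sup>T * ?l\<^sup>T" using transpose_mult[OF l W(1)] W(2) by simp
  finally have "?l = (- (W\<^sup>T * ?l\<^sup>T)) * Y" using Y(2) by simp
  also have "\<dots> = W\<^sup>T * M"
    unfolding M_def using WT l Y(1)
    by (subst uminus_mult_left_mat, simp, subst uminus_mult_right_mat, simp) (simp add: assoc_mult_mat[of _ m n _ m _ n])
  finally have lM: "?l = W\<^sup>T * M" .
  have "inj_mat M"
  proof (rule inj_matI[OF M])
    fix v assume v: "v \<in> carrier_vec n" "M *\<^sub>v v = 0\<^sub>v n"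
    have "?l *\<^sub>v v = W\<^sup>T *\<^sub>v (M *\<^sub>v v)" unfolding lM using WT M v(1) by (rule assoc_mult_mat_vec)
    also have "\<dots> = 0\<^sub>v m" unfolding v(2) using WT by auto
    finally show "v = 0\<^sub>v n" using inj_matD[OF injl l v(1)] by simp
  qed
  then have "det M \<noteq> 0" using inj_mat_square_iff_det[OF M] by simp
  then obtain B where B: "B \<in> carrier_mat n n" "M * B = 1\<^sub>m n" using field_right_inverse[OF M] by blast
  have "?l * B = W\<^sup>T * (M * B)" unfolding lM using WT M B(1) by (rule assoc_mult_mat)
  also have "\<dots> = rat_mat R\<^sup>T" unfolding B(2) using WT R(2) by (simp add: rat_mat_def map_mat_transpose)
  finally have "?l * B = rat_mat R\<^sup>T" .
  then obtain F where F: "F \<in> carrier_mat n n" "B = rat_mat F" "L * F = R\<^sup>T"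
    using rational_solution_mat_is_polynomial[OF L inj B(1), of "R\<^sup>T"] R(1) by auto
  define E where "E = F\<^sup>T"
  have E: "E \<in> carrier_mat n n" unfolding E_def using F(1) by simp
  have LT: "L\<^sup>T \<in> carrier_mat n m" using L by simp
  have "R = (L * F)\<^sup>T" unfolding F(3) by simp
  also have "\<dots> = E * L\<^sup>T" unfolding E_def using transpose_mult[OF L F(1)] .
  finally have PE: "P = L * (E * L\<^sup>T)" using R(3) by simp
  then have PE': "P = L * E * L\<^sup>T" using L E LT by simp
  have ET: "E\<^sup>T \<in> carrier_mat n n" using E by simp
  have injL: "inj_mat L" by (rule inj_mat_of_eval[OF L inj])
  \<comment> \<open>Skew-symmetry of \<open>P\<close> passes to \<open>E\<close> by cancelling
    \<open>L\<close> on the left, transposing, and cancelling \<open>L\<close> again.\<close>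
  have "E\<^sup>T = - E"
  proof -
    have "P\<^sup>T = L * (E\<^sup>T * L\<^sup>T)"
    proof -
      have "P\<^sup>T = (E * L\<^sup>T)\<^sup>T * L\<^sup>T" unfolding PE using transpose_mult[OF L, of "E * L\<^sup>T" m] E LT by simp
      also have "\<dots> = L * E\<^sup>T * L\<^sup>T" using transpose_mult[OF E LT] by simp
      finally show ?thesis using L ET LT by simp
    qed
    then have "L * (E\<^sup>T * L\<^sup>T) = - (L * (E * L\<^sup>T))" using P(2) PE by simp
    also have "\<dots> = L * (- (E * L\<^sup>T))" using L E LT by (subst uminus_mult_right_mat) auto
    finally have "E\<^sup>T * L\<^sup>T = - (E * L\<^sup>T)"
      using inj_mat_mult_cancel[OF injL L, of "E\<^sup>T * L\<^sup>T" m] E ET LT by simp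
    also have "\<dots> = (- E) * L\<^sup>T" using E LT by (subst uminus_mult_left_mat) auto
    finally have "(E\<^sup>T * L\<^sup>T)\<^sup>T = ((- E) * L\<^sup>T)\<^sup>T" by simp
    then have "L * E = L * (- E)\<^sup>T"
      using transpose_mult[OF ET LT] transpose_mult[of "- E" n n "L\<^sup>T" m] E LT by simp
    then have "E = (- E)\<^sup>T" using inj_mat_mult_cancel[OF injL L E, of "(- E)\<^sup>T"] E by simp
    then have "E\<^sup>T = (- E)\<^sup>T\<^sup>T" by simp
    then show ?thesis by simp
  qed
  then have "skew_symmetric_mat E" unfolding skew_symmetric_mat_def using E by simp
  moreover have "normal_rank E = n"
  proof -
    have "det M * det B = 1" using det_mult[OF M B(1)] B(2) by simp
    then have "det B \<noteq> 0" by auto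
    moreover have "det B = to_fract (det F)" unfolding F(2) rat_mat_def by simp
    ultimately have "det F \<noteq> 0" by auto
    then show ?thesis using normal_rank_square_iff[OF E] det_transpose[OF F(1)] unfolding E_def by simp
  qed
  ultimately have "skew_factorization m r P L E"
    unfolding skew_factorization_def using L E PE' min unfolding n_def by simp
  then show ?thesis by blast
qed

subsection \<open>Reversal and the pairing of column degrees\<close>

text \<open>The entrywise action of \<open>rev_mat\<close>. Coefficients above index d are dropped,
  so evaluation agrees with \<lambda>-reversal under the bound d on the degree.\<close>

definition rev_poly :: "nat \<Rightarrow> complex poly \<Rightarrow> complex poly" where
  "rev_poly d p = (\<Sum>i\<le>d. monom (coeff p i) (d - i))"

lemma rev_mat_eq: "rev_mat d A = map_mat (rev_poly d) A"
  unfolding rev_mat_def rev_poly_def ..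

lemma coeff_rev_poly:
  assumes "k \<le> d"
  shows "coeff (rev_poly d p) k = coeff p (d - k)"
proof -
  have "coeff (rev_poly d p) k = (\<Sum>i\<le>d. if i = d - k then coeff p i else 0)"
    unfolding rev_poly_def coeff_sum using assms by (intro sum.cong) auto
  then show ?thesis by simp
qed

lemma poly_rev_poly:
  assumes "degree p \<le> d" and z: "z \<noteq> 0"
  shows "poly (rev_poly d p) z = z ^ d * poly p (1 / z)"
proof -
  have "poly p (1 / z) = (\<Sum>i\<le>d. coeff p i * (1 / z) ^ i)"
    unfolding poly_altdef using assms(1)
    by (intro sum.mono_neutral_left) (auto simp: coeff_eq_0)
  then have "z ^ d * poly p (1 / z) = (\<Sum>i\<le>d. coeff p i * (z ^ d * (1 / z) ^ i))"
    by (simp add: sum_distrib_left mult.left_commute)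
  also have "\<dots> = (\<Sum>i\<le>d. coeff p i * z ^ (d - i))"
    using z by (intro sum.cong) (auto simp: power_diff power_divide)
  finally show ?thesis unfolding rev_poly_def by (simp add: poly_sum poly_monom)
qed

text \<open>Identities between reversals can thus be checked at nonzero points, where 1 / z makes
  sense, without introducing Laurent polynomials.\<close>

lemma poly_eqI_nonzero:
  fixes p q :: "complex poly"
  assumes "\<And>z. z \<noteq> 0 \<Longrightarrow> poly p z = poly q z"
  shows "p = q"
proof (rule ccontr)
  assume "p \<noteq> q"
  then have "finite {z. poly (p - q) z = 0}" by (intro poly_roots_finite) simp
  moreover have "UNIV - {0} \<subseteq> {z. poly (p - q) z = 0}" using assms by auto
  ultimately have "finite (UNIV - {0 :: complex})" by (rule finite_subset[rotated])
  then show False using infinite_UNIV_char_0[where 'a = complex] by simp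
qed

section \<open>Determinants and cancellation under congruence\<close>

lemma congruence_entry:
  fixes L E :: "'a :: comm_ring_1 mat"
  assumes L: "L \<in> carrier_mat m n" and E: "E \<in> carrier_mat n n" and ij: "i < m" "j < m"
  shows "(L * E * L\<^sup>T) $$ (i, j) = (\<Sum>k<n. \<Sum>l<n. L $$ (i, k) * E $$ (k, l) * L $$ (j, l))"
  using assms by (auto simp: scalar_prod_def sum_distrib_left mult.assoc atLeast0LessThan intro!: sum.cong)

lemma det_zero_block:
  fixes A :: "'a :: comm_ring_1 mat"
  assumes A: "A \<in> carrier_mat n n" and i: "i < n"
    and z: "\<And>a b. a \<le> i \<Longrightarrow> b < n - i \<Longrightarrow> A $$ (a, b) = 0"
  shows "det A = 0"
proof -
  have "(\<Prod>a = 0..<n. A $$ (a, p a)) = 0" if p: "p permutes {0..<n}" for p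
  proof -
    have "\<exists>a\<le>i. p a < n - i"
    proof (rule ccontr)
      assume neg: "\<not> ?thesis"
      have "p ` {..i} \<subseteq> {n - i..<n}"
      proof
        fix x assume "x \<in> p ` {..i}"
        then obtain a where a: "a \<le> i" "x = p a" by auto
        then have "p a < n" using permutes_in_image[OF p, of a] i by auto
        then show "x \<in> {n - i..<n}" using neg a by auto
      qed
      then have "card (p ` {..i}) \<le> card {n - i..<n}" by (intro card_mono) auto
      moreover have "card (p ` {..i}) = Suc i"
        using permutes_inj[OF p] by (subst card_image) (auto intro: inj_on_subset)
      ultimately show False using i by simp
    qed
    then obtain a where "a \<le> i" "p a < n - i" by blast
    then have "A $$ (a, p a) = 0" "a \<in> {0..<n}" using z i by auto
    then show ?thesis by (intro prod_zero) auto
  qed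
  then show ?thesis unfolding det_def'[OF A] by (intro sum.neutral) auto
qed

text \<open>A congruence by the diagonal matrix of the \<open>f k\<close>: in each Leibniz product
  every factor \<open>f k\<close> occurs once through its row and once through its column.\<close>

lemma det_scale_rows_cols:
  fixes A :: "'a :: comm_ring_1 mat"
  assumes A: "A \<in> carrier_mat n n"
  shows "det (mat n n (\<lambda>(k, l). f k * f l * A $$ (k, l))) = (\<Prod>k<n. f k)\<^sup>2 * det A"
proof -
  let ?B = "mat n n (\<lambda>(k, l). f k * f l * A $$ (k, l))"
  have B: "?B \<in> carrier_mat n n" by simp
  have "(\<Prod>k = 0..<n. ?B $$ (k, p k)) = (\<Prod>k<n. f k)\<^sup>2 * (\<Prod>k = 0..<n. A $$ (k, p k))"
    if p: "p permutes {0..<n}" for p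
  proof -
    have "p k < n" if "k < n" for k using permutes_in_image[OF p, of k] that by simp
    then have "(\<Prod>k = 0..<n. ?B $$ (k, p k)) = (\<Prod>k = 0..<n. f k * f (p k) * A $$ (k, p k))"
      by (intro prod.cong) auto
    also have "\<dots> = (\<Prod>k = 0..<n. f k) * (\<Prod>k = 0..<n. f (p k)) * (\<Prod>k = 0..<n. A $$ (k, p k))"
      by (simp add: prod.distrib)
    also have "(\<Prod>k = 0..<n. f (p k)) = (\<Prod>k = 0..<n. f k)"
      using prod.permute[OF p, of f] by (simp add: comp_def)
    finally show ?thesis by (simp add: power2_eq_square atLeast0LessThan)
  qed
  then show ?thesis
    unfolding det_def'[OF A] det_def'[OF B] sum_distrib_left
    by (intro sum.cong) (auto simp: mult.left_commute)
qed

lemma dvd_mult_matD: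
  fixes L :: "complex poly mat"
  assumes L: "L \<in> carrier_mat m n" and B: "B \<in> carrier_mat n k" and C: "C \<in> carrier_mat m k" and "q \<noteq> 0"
    and inj: "\<And>\<alpha>. poly q \<alpha> = 0 \<Longrightarrow> inj_mat (eval_mat L \<alpha>)"
    and eq: "L * B = q \<cdot>\<^sub>m C"
  obtains B' where "B' \<in> carrier_mat n k" and "B = q \<cdot>\<^sub>m B'"
proof -
  have "\<exists>w \<in> carrier_vec n. col B j = q \<cdot>\<^sub>v w" if j: "j < k" for j
  proof (rule dvd_mult_mat_vecD[OF L _ \<open>q \<noteq> 0\<close> inj])
    fix i assume i: "i < m"
    have "(L *\<^sub>v col B j) $ i = (L * B) $$ (i, j)" using L B i j by simp
    also have "\<dots> = q * C $$ (i, j)" unfolding eq using C i j by simp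
    finally show "q dvd (L *\<^sub>v col B j) $ i" by simp
  qed (use B j in auto)
  then have "\<forall>j. \<exists>w. j < k \<longrightarrow> w \<in> carrier_vec n \<and> col B j = q \<cdot>\<^sub>v w" by blast
  then obtain f where f: "\<And>j. j < k \<Longrightarrow> f j \<in> carrier_vec n \<and> col B j = q \<cdot>\<^sub>v f j" by metis
  have "B $$ (i, j) = q * f j $ i" if "i < n" "j < k" for i j
  proof -
    have "B $$ (i, j) = col B j $ i" using B that by simp
    then show ?thesis using f[OF that(2)] that(1) by (metis carrier_vecD index_smult_vec(1))
  qed
  then have "B = q \<cdot>\<^sub>m mat n k (\<lambda>(i, j). f j $ i)" using B by (intro eq_matI) auto
  then show ?thesis by (rule that[rotated]) simp
qed

text \<open>The left factor \<open>L\<close> is cancelled first; transposing turns the right factor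
  into a left one, which is cancelled in the same way.\<close>

lemma congruence_dvdD:
  fixes L :: "complex poly mat"
  assumes L: "L \<in> carrier_mat m n" and F: "F \<in> carrier_mat n n" and C: "C \<in> carrier_mat m m" and q: "q \<noteq> 0"
    and inj: "\<And>\<alpha>. poly q \<alpha> = 0 \<Longrightarrow> inj_mat (eval_mat L \<alpha>)"
    and eq: "L * F * L\<^sup>T = q \<cdot>\<^sub>m C"
  obtains G where "G \<in> carrier_mat n n" and "F = q \<cdot>\<^sub>m G" and "L * G * L\<^sup>T = C"
proof -
  have LT: "L\<^sup>T \<in> carrier_mat n m" and FT: "F\<^sup>T \<in> carrier_mat n n" using L F by simp_all
  have FL: "F * L\<^sup>T \<in> carrier_mat n m" using F LT by simp
  have "L * (F * L\<^sup>T) = q \<cdot>\<^sub>m C" using eq L F LT by simp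
  then obtain B where B: "B \<in> carrier_mat n m" "F * L\<^sup>T = q \<cdot>\<^sub>m B"
    using dvd_mult_matD[OF L FL C q inj] by metis
  have "L * F\<^sup>T = (F * L\<^sup>T)\<^sup>T" using transpose_mult[OF F LT] by simp
  also have "\<dots> = q \<cdot>\<^sub>m B\<^sup>T" unfolding B(2) by (rule eq_matI) auto
  finally have "L * F\<^sup>T = q \<cdot>\<^sub>m B\<^sup>T" .
  then obtain H where H: "H \<in> carrier_mat n n" "F\<^sup>T = q \<cdot>\<^sub>m H"
    using dvd_mult_matD[OF L FT _ q inj, of "B\<^sup>T"] B(1) by (metis transpose_carrier_mat)
  define G where "G = H\<^sup>T"
  have G: "G \<in> carrier_mat n n" unfolding G_def using H by simp
  have "F = F\<^sup>T\<^sup>T" by simp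
  also have "\<dots> = q \<cdot>\<^sub>m G" unfolding H(2) G_def by (rule eq_matI) auto
  finally have FG: "F = q \<cdot>\<^sub>m G" .
  have "q \<cdot>\<^sub>m (L * G * L\<^sup>T) = q \<cdot>\<^sub>m C"
  proof -
    have "L * F * L\<^sup>T = q \<cdot>\<^sub>m (L * G) * L\<^sup>T" unfolding FG using mult_smult_distrib[OF L G] by simp
    also have "\<dots> = q \<cdot>\<^sub>m (L * G * L\<^sup>T)" using mult_smult_assoc_mat[of "L * G" m n "L\<^sup>T" m] L G LT by simp
    finally show ?thesis using eq by simp
  qed
  have "L * G * L\<^sup>T = C"
  proof (rule eq_matI)
    fix i j assume ij: "i < dim_row C" "j < dim_col C"
    have "(q \<cdot>\<^sub>m (L * G * L\<^sup>T)) $$ (i, j) = (q \<cdot>\<^sub>m C) $$ (i, j)"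
      unfolding \<open>q \<cdot>\<^sub>m (L * G * L\<^sup>T) = q \<cdot>\<^sub>m C\<close> ..
    then have "q * (L * G * L\<^sup>T) $$ (i, j) = q * C $$ (i, j)"
      using ij C L G by (simp only: index_smult_mat index_mult_mat carrier_matD index_transpose_mat)
    then show "(L * G * L\<^sup>T) $$ (i, j) = C $$ (i, j)" using mult_left_cancel[OF q] by blast
  qed (use L C in auto)
  then show ?thesis using that G FG by blast
qed

lemma degree_le_mat_degree:
  assumes ij: "i < dim_row A" "j < dim_col A"
  shows "degree (A $$ (i, j)) \<le> mat_degree A"
proof (cases "A $$ (i, j) = 0")
  case False
  let ?S = "{k. mat_coeff A k \<noteq> 0\<^sub>m (dim_row A) (dim_col A)}"
  have "?S \<subseteq> (\<Union>i<dim_row A. \<Union>j<dim_col A. {..degree (A $$ (i, j))})"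
  proof
    fix k assume "k \<in> ?S"
    then obtain i j where "i < dim_row A" "j < dim_col A" "coeff (A $$ (i, j)) k \<noteq> 0"
      by (auto simp: mat_coeff_def mat_eq_iff)
    then show "k \<in> (\<Union>i<dim_row A. \<Union>j<dim_col A. {..degree (A $$ (i, j))})" using le_degree by blast
  qed
  then have "finite ?S" by (rule finite_subset) auto
  moreover have "degree (A $$ (i, j)) \<in> ?S"
  proof -
    have "mat_coeff A (degree (A $$ (i, j))) $$ (i, j) \<noteq> 0" using ij False by (simp add: mat_coeff_def)
    then show ?thesis using ij by auto
  qed
  ultimately show ?thesis unfolding mat_degree_def by (intro Max_ge) auto
qed simp

text \<open>Reversing the columns of \<open>L\<close> individually turns the factorisation of \<open>P\<close> into one of its
  reversal; the middle factor is at first only a Laurent polynomial, and \<open>N\<close> clears its poles.\<close>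

theorem reversed_factorization:
  fixes L E :: "complex poly mat" and \<delta> :: "nat \<Rightarrow> nat"
  assumes L: "L \<in> carrier_mat m n" and E: "E \<in> carrier_mat n n"
    and lead: "inj_mat (lead_mat L)" and \<delta>: "\<And>k. \<delta> k = vec_degree (col L k)"
    and deg: "\<And>i j. i < m \<Longrightarrow> j < m \<Longrightarrow> degree ((L * E * L\<^sup>T) $$ (i, j)) \<le> d"
  shows "\<exists>L' \<in> carrier_mat m n. \<exists>E' \<in> carrier_mat n n.
    eval_mat L' 0 = lead_mat L \<and> rev_mat d (L * E * L\<^sup>T) = L' * E' * L'\<^sup>T \<and>
    (\<forall>k<n. \<forall>l<n. \<forall>z. z \<noteq> 0 \<longrightarrow>
       z ^ \<delta> k * z ^ \<delta> l * poly (E' $$ (k, l)) z = z ^ d * poly (E $$ (k, l)) (1 / z)) \<and>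
    (\<forall>k<n. \<forall>l<n. d < \<delta> k + \<delta> l \<longrightarrow> E $$ (k, l) = 0)"
proof -
  let ?P = "L * E * L\<^sup>T"
  \<comment> \<open>A crude bound, large enough that the exponents \<open>g k l\<close> below
    involve no truncated subtraction and bound the degrees of the entries of
    \<open>E\<close>.\<close>
  define N where "N = (\<Sum>k<n. \<Sum>l<n. \<delta> k + \<delta> l + degree (E $$ (k, l)))"
  have N: "\<delta> k + \<delta> l + degree (E $$ (k, l)) \<le> N" if "k < n" "l < n" for k l
  proof -
    have "\<delta> k + \<delta> l + degree (E $$ (k, l)) \<le> (\<Sum>l<n. \<delta> k + \<delta> l + degree (E $$ (k, l)))"
      using that by (intro member_le_sum) auto
    also have "\<dots> \<le> N" unfolding N_def using that
      by (intro member_le_sum[of k _ "\<lambda>k. \<Sum>l<n. \<delta> k + \<delta> l + degree (E $$ (k, l))"]) auto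
    finally show ?thesis .
  qed
  define L' where "L' = mat m n (\<lambda>(i, k). rev_poly (\<delta> k) (L $$ (i, k)))"
  define g where "g k l = N + d - \<delta> k - \<delta> l" for k l
  define F where "F = mat n n (\<lambda>(k, l). rev_poly (g k l) (E $$ (k, l)))"
  have L': "L' \<in> carrier_mat m n" unfolding L'_def by simp
  have F: "F \<in> carrier_mat n n" unfolding F_def by simp
  have P: "?P \<in> carrier_mat m m" using L E by simp
  have R: "rev_mat d ?P \<in> carrier_mat m m" unfolding rev_mat_eq using P by simp
  have lead': "eval_mat L' 0 = lead_mat L"
  proof (rule eq_matI)
    fix i k assume "i < dim_row (lead_mat L)" "k < dim_col (lead_mat L)"
    then show "eval_mat L' 0 $$ (i, k) = lead_mat L $$ (i, k)"
      using L by (simp add: lead_mat_def L'_def poly_0_coeff_0 coeff_rev_poly \<delta>)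
  qed (use L in \<open>auto simp: lead_mat_def L'_def\<close>)
  have L'z: "poly (L' $$ (i, k)) z = z ^ \<delta> k * poly (L $$ (i, k)) (1 / z)"
    if "i < m" "k < n" "z \<noteq> 0" for i k z
    using poly_rev_poly[of "L $$ (i, k)" "\<delta> k" z] degree_entry_le_vec_degree_col[OF L] that
    by (simp add: L'_def \<delta>)
  have gN: "g k l + \<delta> k + \<delta> l = N + d" "degree (E $$ (k, l)) \<le> g k l" if "k < n" "l < n" for k l
    using N[OF that] unfolding g_def by linarith+
  have Fz: "z ^ \<delta> k * z ^ \<delta> l * poly (F $$ (k, l)) z = z ^ (N + d) * poly (E $$ (k, l)) (1 / z)"
    if "k < n" "l < n" "z \<noteq> 0" for k l z
  proof -
    have "z ^ \<delta> k * z ^ \<delta> l * poly (F $$ (k, l)) z = z ^ (g k l + \<delta> k + \<delta> l) * poly (E $$ (k, l)) (1 / z)"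
      using poly_rev_poly[OF gN(2)[OF that(1,2)] that(3)] that by (simp add: F_def power_add)
    then show ?thesis using gN(1)[OF that(1,2)] by simp
  qed
  have eq: "L' * F * L'\<^sup>T = monom 1 N \<cdot>\<^sub>m rev_mat d ?P"
  proof (rule eq_matI)
    fix i j assume "i < dim_row (monom 1 N \<cdot>\<^sub>m rev_mat d ?P)" "j < dim_col (monom 1 N \<cdot>\<^sub>m rev_mat d ?P)"
    then have ij: "i < m" "j < m" using R by auto
    have "poly ((L' * F * L'\<^sup>T) $$ (i, j)) z = poly ((monom 1 N \<cdot>\<^sub>m rev_mat d ?P) $$ (i, j)) z"
      if z: "z \<noteq> 0" for z
    proof -
      have "poly ((L' * F * L'\<^sup>T) $$ (i, j)) z =
          (\<Sum>k<n. \<Sum>l<n. poly (L' $$ (i, k)) z * poly (F $$ (k, l)) z * poly (L' $$ (j, l)) z)"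
        unfolding congruence_entry[OF L' F ij] by (simp add: poly_sum)
      also have "\<dots> = (\<Sum>k<n. \<Sum>l<n. z ^ (N + d) *
          (poly (L $$ (i, k)) (1 / z) * poly (E $$ (k, l)) (1 / z) * poly (L $$ (j, l)) (1 / z)))"
      proof (intro sum.cong refl)
        fix k l assume "k \<in> {..<n}" "l \<in> {..<n}"
        then have kl: "k < n" "l < n" by auto
        have "poly (L' $$ (i, k)) z * poly (F $$ (k, l)) z * poly (L' $$ (j, l)) z =
            poly (L $$ (i, k)) (1 / z) * (z ^ \<delta> k * z ^ \<delta> l * poly (F $$ (k, l)) z) * poly (L $$ (j, l)) (1 / z)"
          using L'z[OF ij(1) kl(1) z] L'z[OF ij(2) kl(2) z] by (simp add: mult_ac)
        then show "poly (L' $$ (i, k)) z * poly (F $$ (k, l)) z * poly (L' $$ (j, l)) z = z ^ (N + d) *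
          (poly (L $$ (i, k)) (1 / z) * poly (E $$ (k, l)) (1 / z) * poly (L $$ (j, l)) (1 / z))"
          unfolding Fz[OF kl z] by (simp only: mult_ac)
      qed
      also have "\<dots> = z ^ (N + d) * poly (?P $$ (i, j)) (1 / z)"
        unfolding congruence_entry[OF L E ij] by (simp add: poly_sum sum_distrib_left)
      also have "\<dots> = z ^ N * poly (rev_poly d (?P $$ (i, j))) z"
        using poly_rev_poly[OF deg[OF ij] z] by (simp add: power_add)
      also have "\<dots> = poly ((monom 1 N \<cdot>\<^sub>m rev_mat d ?P) $$ (i, j)) z"
      proof -
        have "(monom 1 N \<cdot>\<^sub>m rev_mat d ?P) $$ (i, j) = monom 1 N * rev_poly d (?P $$ (i, j))"
          using ij carrier_matD[OF P] unfolding rev_mat_eq by (simp del: index_mult_mat)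
        then show ?thesis by (simp add: poly_monom)
      qed
      finally show ?thesis .
    qed
    then show "(L' * F * L'\<^sup>T) $$ (i, j) = (monom 1 N \<cdot>\<^sub>m rev_mat d ?P) $$ (i, j)" by (rule poly_eqI_nonzero)
  qed (use L' R in auto)
  \<comment> \<open>0 is the only possible root of \<open>monom 1 N\<close>, so full rank of the
    leading coefficient matrix is all that the cancellation of this power requires.\<close>
  have inj0: "inj_mat (eval_mat L' 0)" using lead lead' by simp
  have "inj_mat (eval_mat L' \<alpha>)" if "poly (monom 1 N) \<alpha> = 0" for \<alpha>
  proof -
    have "\<alpha> = 0" using that by (simp add: poly_monom)
    then show ?thesis using inj0 by simp
  qed
  then obtain E' where E': "E' \<in> carrier_mat n n" "F = monom 1 N \<cdot>\<^sub>m E'" "L' * E' * L'\<^sup>T = rev_mat d ?P"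
    using congruence_dvdD[OF L' F R _ _ eq] by auto
  have FE': "F $$ (k, l) = monom 1 N * E' $$ (k, l)" if "k < n" "l < n" for k l
    unfolding E'(2) using E'(1) that by simp
  have "z ^ \<delta> k * z ^ \<delta> l * poly (E' $$ (k, l)) z = z ^ d * poly (E $$ (k, l)) (1 / z)"
    if "k < n" "l < n" "z \<noteq> 0" for k l z
  proof -
    have "z ^ N * (z ^ \<delta> k * z ^ \<delta> l * poly (E' $$ (k, l)) z) = z ^ N * (z ^ d * poly (E $$ (k, l)) (1 / z))"
      using Fz[OF that] FE'[OF that(1,2)] by (simp add: poly_monom power_add mult_ac)
    then show ?thesis using that(3) by simp
  qed
  moreover have "E $$ (k, l) = 0" if "k < n" "l < n" "d < \<delta> k + \<delta> l" for k l
  proof (rule poly_eqI)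
    fix t
    \<comment> \<open>The entry of \<open>F\<close> is a multiple of \<open>monom 1 N\<close>, so
      its coefficients at indices up to \<open>g k l\<close> vanish; read backwards, they are all
      the coefficients of the entry of \<open>E\<close> up to its degree.\<close>
    have gl: "g k l < N" using gN(1)[OF that(1,2)] that(3) by simp
    show "coeff (E $$ (k, l)) t = coeff 0 t"
    proof (cases "t \<le> g k l")
      case True
      have "coeff (E $$ (k, l)) t = coeff (F $$ (k, l)) (g k l - t)"
        using True that by (simp add: F_def coeff_rev_poly)
      also have "\<dots> = 0" unfolding FE'[OF that(1,2)] using gl by (simp add: coeff_monom_mult)
      finally show ?thesis by simp
    next
      case False
      then show ?thesis using gN(2)[OF that(1,2)] by (simp add: coeff_eq_0)
    qed
  qed
  ultimately show ?thesis
    using L' E'(1) lead' E'(3) by (intro bexI[of _ L'] bexI[of _ E'] conjI) auto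
qed

text \<open>Summed over i, the left-hand sides give twice the sum of \<delta>, that is n d; one
  strict inequality would make this total too small.\<close>

lemma pairing_of_degrees:
  fixes \<delta> :: "nat \<Rightarrow> nat"
  assumes le: "\<And>i. i < n \<Longrightarrow> \<delta> i + \<delta> (n - 1 - i) \<le> d" and sum: "2 * (\<Sum>i<n. \<delta> i) = n * d" and i: "i < n"
  shows "\<delta> i + \<delta> (n - 1 - i) = d"
proof (rule ccontr)
  assume "\<not> ?thesis"
  then have lt: "\<delta> i + \<delta> (n - 1 - i) < d" using le[OF i] by simp
  have "(\<Sum>i<n. \<delta> i + \<delta> (n - 1 - i)) < (\<Sum>i<n. d)"
    using le lt i by (intro sum_strict_mono_ex1) auto
  moreover have "(\<Sum>i<n. \<delta> (n - 1 - i)) = (\<Sum>i<n. \<delta> i)"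
    using sum.nat_diff_reindex[of \<delta> n] by simp
  ultimately show False using sum by (simp add: sum.distrib)
qed

theorem minimal_indices_pairing:
  assumes L: "L \<in> carrier_mat m n" and E: "E \<in> carrier_mat n n" and min: "minimal_basis m V (cols L)"
    and detE: "det E \<noteq> 0" and P: "P = L * E * L\<^sup>T" and deg: "mat_degree P \<le> d"
    and fin: "\<And>\<alpha>. \<not> finite_eigenvalue P \<alpha>" and inf: "\<not> infinite_eigenvalue d P"
    and mono: "\<And>i j. i \<le> j \<Longrightarrow> j < n \<Longrightarrow> vec_degree (col L j) \<le> vec_degree (col L i)"
    and i: "i < n"
  shows "vec_degree (col L i) + vec_degree (col L (n - 1 - i)) = d"
proof -
  define \<delta> where "\<delta> k = vec_degree (col L k)" for k
  have Pc: "P \<in> carrier_mat m m" unfolding P using L E by simp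
  have "poly (det E) \<alpha> \<noteq> 0" for \<alpha>
    using congruence_eval_det[OF L E minimal_basis_inj_eval[OF L min] detE] fin P by blast
  then obtain c where c: "det E = [:c:]"
    using fundamental_theorem_of_algebra[of "det E"] constant_degree[of "det E"] by (metis degree_eq_zeroE)
  have c0: "c \<noteq> 0" using detE c by simp
  have "degree ((L * E * L\<^sup>T) $$ (i, j)) \<le> d" if "i < m" "j < m" for i j
    using degree_le_mat_degree[of i P j] deg carrier_matD[OF Pc] that unfolding P[symmetric] by simp
  from reversed_factorization[OF L E minimal_basis_inj_lead[OF L min] \<delta>_def this]
  obtain L' E' where L': "L' \<in> carrier_mat m n" and E': "E' \<in> carrier_mat n n"
    and lead: "eval_mat L' 0 = lead_mat L" and rev: "rev_mat d P = L' * E' * L'\<^sup>T"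
    and entry: "\<And>k l z. k < n \<Longrightarrow> l < n \<Longrightarrow> z \<noteq> 0 \<Longrightarrow>
           z ^ \<delta> k * z ^ \<delta> l * poly (E' $$ (k, l)) z = z ^ d * poly (E $$ (k, l)) (1 / z)"
    and zero: "\<And>k l. k < n \<Longrightarrow> l < n \<Longrightarrow> d < \<delta> k + \<delta> l \<Longrightarrow> E $$ (k, l) = 0"
    unfolding P by metis
  let ?S = "\<Sum>k<n. \<delta> k"
  \<comment> \<open>Determinants of the entrywise relation: scaling rows and columns by the powers
    with exponents \<delta> contributes 2 \<open>?S\<close> to the exponent, the scalar on the other
    side contributes n d.\<close>
  have "poly (monom 1 (2 * ?S) * det E') z = poly (monom c (n * d)) z" if z: "z \<noteq> 0" for z
  proof -
    have "mat n n (\<lambda>(k, l). z ^ \<delta> k * z ^ \<delta> l * eval_mat E' z $$ (k, l)) = z ^ d \<cdot>\<^sub>m eval_mat E (1 / z)"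
      using entry z E E' by (intro eq_matI) auto
    then have "(\<Prod>k<n. z ^ \<delta> k)\<^sup>2 * det (eval_mat E' z) = det (z ^ d \<cdot>\<^sub>m eval_mat E (1 / z))"
      using det_scale_rows_cols[of "eval_mat E' z" n "\<lambda>k. z ^ \<delta> k"] E' by simp
    then have "(\<Prod>k<n. z ^ \<delta> k)\<^sup>2 * poly (det E') z = (z ^ d) ^ n * c"
      using E c by simp
    moreover have "(\<Prod>k<n. z ^ \<delta> k)\<^sup>2 = z ^ (2 * ?S)"
      by (simp add: power_sum[symmetric] power_mult[symmetric] mult.commute)
    ultimately show ?thesis by (simp add: poly_monom power_mult[symmetric] mult.commute)
  qed
  then have detE': "monom 1 (2 * ?S) * det E' = monom c (n * d)" by (rule poly_eqI_nonzero)
  then have "det E' \<noteq> 0" using c0 by auto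
  then have "poly (det E') 0 \<noteq> 0"
    using congruence_eval_det[OF L' E', of 0] lead minimal_basis_inj_lead[OF L min] inf
    unfolding infinite_eigenvalue_def rev by simp
  \<comment> \<open>This coefficient is the value of \<open>det E'\<close> at 0. Being nonzero in a
    monomial of degree n d, it must sit at index n d.\<close>
  then have "coeff (monom 1 (2 * ?S) * det E') (2 * ?S) \<noteq> 0"
    by (simp add: coeff_monom_mult poly_0_coeff_0)
  then have S: "2 * ?S = n * d" unfolding detE' by (simp split: if_splits)
  have "\<delta> i + \<delta> (n - 1 - i) \<le> d" if i: "i < n" for i
  proof (rule ccontr)
    assume neg: "\<not> ?thesis"
    \<comment> \<open>By the decreasing order, the excess at the pair i, n - 1 - i spreads to all
      smaller indices, which fills a block large enough to make \<open>E\<close> singular.\<close>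
    have "E $$ (a, b) = 0" if "a \<le> i" "b < n - i" for a b
    proof (rule zero)
      have "\<delta> i \<le> \<delta> a" "\<delta> (n - 1 - i) \<le> \<delta> b"
        unfolding \<delta>_def using mono[of a i] mono[of b "n - 1 - i"] that i by auto
      then show "d < \<delta> a + \<delta> b" using neg by simp
    qed (use that i in auto)
    then have "det E = 0" using det_zero_block[OF E i] by blast
    then show False using detE by simp
  qed
  then show ?thesis using pairing_of_degrees[of n \<delta> d, OF _ S i] unfolding \<delta>_def by blast
qed

theorem lemma3p2:
  fixes m r d :: nat
  assumes "m > 0" and "r > 0"
  shows "(\<forall>P. P \<in> POL_ss d (2 * r) m \<and> normal_rank P = 2 * r \<longrightarrow>
            (\<exists>L E. skew_factorization m r P L E)) \<and>
         (\<forall>P L E. P \<in> POL_ss d (2 * r) m \<and> normal_rank P = 2 * r \<and> mat_degree P = d \<and>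
            (\<forall>\<alpha>. \<not> finite_eigenvalue P \<alpha>) \<and> \<not> infinite_eigenvalue d P \<and>
            skew_factorization m r P L E \<and>
            (\<forall>i j. i \<le> j \<and> j < 2 * r \<longrightarrow> vec_degree (col L j) \<le> vec_degree (col L i)) \<longrightarrow>
            (\<forall>i \<in> {1..2 * r}.
               vec_degree (col L (i - 1)) + vec_degree (col L (2 * r - i + 1 - 1)) = d))"
proof (intro conjI allI impI ballI)
  fix P assume "P \<in> POL_ss d (2 * r) m \<and> normal_rank P = 2 * r"
  then show "\<exists>L E. skew_factorization m r P L E"
    using skew_factorization_exists POL_ss_skew by blast
next
  fix P L E i
  assume A: "P \<in> POL_ss d (2 * r) m \<and> normal_rank P = 2 * r \<and> mat_degree P = d \<and>
            (\<forall>\<alpha>. \<not> finite_eigenvalue P \<alpha>) \<and> \<not> infinite_eigenvalue d P \<and>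
            skew_factorization m r P L E \<and>
            (\<forall>i j. i \<le> j \<and> j < 2 * r \<longrightarrow> vec_degree (col L j) \<le> vec_degree (col L i))"
    and i: "i \<in> {1..2 * r}"
  then have L: "L \<in> carrier_mat m (2 * r)" and E: "E \<in> carrier_mat (2 * r) (2 * r)"
    and P: "P = L * E * L\<^sup>T" and min: "minimal_basis m (rat_col_space P) (cols L)"
    and rk: "normal_rank E = 2 * r"
    unfolding skew_factorization_def by blast+
  have "det E \<noteq> 0" using normal_rank_square_iff[OF E] rk by simp
  then have "vec_degree (col L (i - 1)) + vec_degree (col L (2 * r - 1 - (i - 1))) = d"
    using A i by (intro minimal_indices_pairing[OF L E min _ P]) auto
  \<comment> \<open>Matches the indices counted from 0 with the statement, which subtracts 1 from
    each index counted from 1.\<close>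
  moreover have "2 * r - 1 - (i - 1) = 2 * r - i + 1 - 1" using i by auto
  ultimately show "vec_degree (col L (i - 1)) + vec_degree (col L (2 * r - i + 1 - 1)) = d" by simp
qed

end
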